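(* Let $n\ge 1$, let $F:\mathbb{R}^n\to\mathbb{R}^n$ be a rational nonsingular map, and let $d=[\mathbb{R}(X):\mathbb{R}(F)]$ be its extension degree. Then every fiber $F^{-1}(y)$, $y\in\mathbb{R}^n$, is finite of size at most $d$, and the maximum fiber size $N=\max_{y\in\mathbb{R}^n}|F^{-1}(y)|$ has the same parity as $d$.
   Context: A map $F:\mathbb{R}^n\to\mathbb{R}^n$ is an everywhere defined rational map if each component can be expressed as a quotient of two real polynomials in $n$ variables with denominator vanishing nowhere on $\mathbb{R}^n$. A rational nonsingular map is an everywhere defined rational map $F:\mathbb{R}^n\to\mathbb{R}^n$ whose Jacobian determinant $j(F)$ vanishes nowhere on $\mathbb{R}^n$. Write $\mathbb{R}(X)=\mathbb{R}(x_1,\dots,x_n)$ for the rational function field on the domain and $\mathbb{R}(F)\subseteq\mathbb{R}(X)$ for the subfield generated over $\mathbb{R}$ by the components of $F$; for a rational nonsingular map, $\mathbb{R}(X)/\mathbb{R}(F)$ is a finite algebraic extension, and its degree is called the extension degree of $F$. *)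

theory Defs
  imports
    "HOL-Analysis.Analysis"
    "HOL-Library.Poly_Mapping"
    "HOL-Computational_Algebra.Fraction_Field"
    "HOL-Algebra.Embedded_Algebras"
    "HOL-Algebra.Generated_Fields"
    "HOL-Algebra.Algebraic_Closure_Type"
begin

text \<open>
  Real polynomials in the variables \<open>x\<^sub>i\<close>, \<open>i :: 'n\<close>: finitely supported maps from
  exponent vectors to coefficients, with convolution as product. \<^theory>\<open>HOL-Library.Poly_Mapping\<close>
  proves that this ring is an integral domain only for linearly ordered index types. The order
  plays no other role, and every dimension is still covered, since index types such as
  \<^typ>\<open>5\<close> from \<^theory>\<open>HOL-Library.Numeral_Type\<close> are linearly ordered.
\<close>

type_synonym 'n real_mpoly = "('n \<Rightarrow>\<^sub>0 nat) \<Rightarrow>\<^sub>0 real"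

definition mpoly_eval :: "'n::finite real_mpoly \<Rightarrow> real ^ 'n \<Rightarrow> real" where
  "mpoly_eval p x =
     (\<Sum>m\<in>Poly_Mapping.keys p. Poly_Mapping.lookup p m * (\<Prod>i\<in>UNIV. (x $ i) ^ Poly_Mapping.lookup m i))"

definition regular_quotient ::
    "(real ^ 'n::finite \<Rightarrow> real) \<Rightarrow> 'n real_mpoly \<Rightarrow> 'n real_mpoly \<Rightarrow> bool" where
  "regular_quotient f p q \<longleftrightarrow>
     (\<forall>x. mpoly_eval q x \<noteq> 0) \<and> (\<forall>x. f x = mpoly_eval p x / mpoly_eval q x)"

definition everywhere_defined_rational_map :: "(real ^ 'n::finite \<Rightarrow> real ^ 'n) \<Rightarrow> bool" where
  "everywhere_defined_rational_map F \<longleftrightarrow> (\<forall>i. \<exists>p q. regular_quotient (\<lambda>x. F x $ i) p q)"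

definition rational_nonsingular_map :: "(real ^ 'n::finite \<Rightarrow> real ^ 'n) \<Rightarrow> bool" where
  "rational_nonsingular_map F \<longleftrightarrow>
     everywhere_defined_rational_map F \<and> (\<forall>x. det (jacobian F (at x)) \<noteq> 0)"

type_synonym 'n ratfun = "'n real_mpoly fract"

abbreviation ratfun_field :: "'n::{finite,linorder} ratfun ring" where
  "ratfun_field \<equiv> ring_of_type_algebra"

definition ratfun_constants :: "'n::{finite,linorder} ratfun set" where
  "ratfun_constants = {Fract (Poly_Mapping.single 0 c) 1 | c. True}"

text \<open>
  The elements of the rational function field given by the components of \<open>F\<close>. A real rational
  function is determined by its values, so each component contributes exactly one element, which
  does not depend on the chosen quotient.
\<close>

definition component_ratfuns ::
    "(real ^ 'n::{finite,linorder} \<Rightarrow> real ^ 'n::{finite,linorder}) \<Rightarrow> 'n ratfun set" where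
  "component_ratfuns F = {Fract p q | p q i. regular_quotient (\<lambda>x. F x $ i) p q}"

definition component_field ::
    "(real ^ 'n::{finite,linorder} \<Rightarrow> real ^ 'n::{finite,linorder}) \<Rightarrow> 'n ratfun set" where
  "component_field F = generate_field ratfun_field (ratfun_constants \<union> component_ratfuns F)"

text \<open>
  The library's dimension is a definite description, so the value is unspecified if the extension
  is not finite; for rational nonsingular maps it is always finite.
\<close>

definition extension_degree :: "(real ^ 'n::{finite,linorder} \<Rightarrow> real ^ 'n::{finite,linorder}) \<Rightarrow> nat" where
  "extension_degree F =
     ring.dim ratfun_field (component_field F) (carrier ratfun_field)"

end

theory Submission
  imports Defs
begin

text \<open>
  For a suitable real vector \<open>c\<close>, the linear form \<open>h = \<Sum>\<^sub>i c\<^sub>i x\<^sub>i\<close> is a primitive element of \<open>\<real>(X)\<close> over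
  \<open>\<real>(F)\<close>. To find it, take \<open>n\<close> further variables \<open>t\<close>: counting monomials shows that
  \<open>u = \<Sum>\<^sub>i t\<^sub>i x\<^sub>i\<close>, \<open>t\<close> and \<open>F\<close> satisfy a nontrivial relation \<open>P(u, t, F) = 0\<close>. If its degree in \<open>u\<close> is
  minimal, then differentiating by \<open>t\<^sub>i\<close> gives \<open>P\<^sub>u x\<^sub>i + P\<^sub>t\<^sub>i = 0\<close> with \<open>P\<^sub>u\<close> not identically
  zero, and specialising \<open>t\<close> to \<open>c\<close> expresses every \<open>x\<^sub>i\<close> rationally in \<open>h\<close> and \<open>F\<close>.

  Hence the extension degree \<open>d\<close> is the degree of the minimal polynomial of \<open>h\<close>. For \<open>y\<close> outside a proper
  algebraic subset, \<open>h\<close> maps the fiber over \<open>y\<close> bijectively onto the real roots of this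
  polynomial specialised at \<open>y\<close>. All these roots are simple, so their number is at most \<open>d\<close>
  and congruent to \<open>d\<close> modulo 2. As \<open>F\<close> is open, points near \<open>y\<close> have at least as many preimages as
  any finite part of the fiber over \<open>y\<close>, so the bound extends to all fibers and the maximum
  is attained at a generic point.
\<close>

section \<open>Evaluation of polynomials\<close>

text \<open>Evaluation in an arbitrary commutative ring along a map of scalars. It serves for real
  values, for rational functions and for univariate polynomials over either, so the homomorphism
  laws are proved once.\<close>

definition mpoly_subst :: "(real \<Rightarrow> 'a::comm_ring_1) \<Rightarrow> ('n::finite \<Rightarrow> 'a) \<Rightarrow> 'n real_mpoly \<Rightarrow> 'a" where
  "mpoly_subst \<kappa> f p =
     (\<Sum>m\<in>Poly_Mapping.keys p. \<kappa> (Poly_Mapping.lookup p m) * (\<Prod>i\<in>UNIV. f i ^ Poly_Mapping.lookup m i))"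

lemma mpoly_eval_eq_subst: "mpoly_eval p x = mpoly_subst id (\<lambda>i. x $ i) p"
  by (simp add: mpoly_eval_def mpoly_subst_def)

lemma mpoly_eq_sum_single:
  fixes p :: "'n real_mpoly"
  shows "p = (\<Sum>m\<in>Poly_Mapping.keys p. Poly_Mapping.single m (Poly_Mapping.lookup p m))"
proof (rule poly_mapping_eqI)
  fix k
  have "(\<Sum>m\<in>Poly_Mapping.keys p. Poly_Mapping.lookup (Poly_Mapping.single m (Poly_Mapping.lookup p m)) k)
      = (\<Sum>m\<in>Poly_Mapping.keys p. if m = k then Poly_Mapping.lookup p k else 0)"
    by (intro sum.cong) (auto simp: lookup_single)
  also have "\<dots> = Poly_Mapping.lookup p k"
    by (auto simp: in_keys_iff)
  finally show "Poly_Mapping.lookup p k = Poly_Mapping.lookup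
      (\<Sum>m\<in>Poly_Mapping.keys p. Poly_Mapping.single m (Poly_Mapping.lookup p m)) k"
    by (simp add: lookup_sum)
qed

locale scalar_hom =
  fixes \<kappa> :: "real \<Rightarrow> 'a::comm_ring_1"
  assumes add: "\<kappa> (a + b) = \<kappa> a + \<kappa> b"
    and mult: "\<kappa> (a * b) = \<kappa> a * \<kappa> b"
    and one [simp]: "\<kappa> 1 = 1"
begin

lemma zero [simp]: "\<kappa> 0 = 0"
  using add[of 0 0] by simp

lemma subst_superset:
  assumes "finite S" "Poly_Mapping.keys p \<subseteq> S"
  shows "mpoly_subst \<kappa> f p =
     (\<Sum>m\<in>S. \<kappa> (Poly_Mapping.lookup p m) * (\<Prod>i\<in>UNIV. f i ^ Poly_Mapping.lookup m i))"
  unfolding mpoly_subst_def using assms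
  by (intro sum.mono_neutral_left) (auto simp: in_keys_iff)

lemma subst_0 [simp]: "mpoly_subst \<kappa> f 0 = 0"
  by (simp add: mpoly_subst_def)

lemma subst_single:
  "mpoly_subst \<kappa> f (Poly_Mapping.single m c) = \<kappa> c * (\<Prod>i\<in>UNIV. f i ^ Poly_Mapping.lookup m i)"
  by (subst subst_superset[of "{m}"]) auto

lemma subst_const [simp]: "mpoly_subst \<kappa> f (Poly_Mapping.single 0 c) = \<kappa> c"
  by (simp add: subst_single)

lemma subst_1 [simp]: "mpoly_subst \<kappa> f 1 = 1"
  using subst_const[of f 1] by (simp only: single_one one)

lemma subst_add: "mpoly_subst \<kappa> f (p + q) = mpoly_subst \<kappa> f p + mpoly_subst \<kappa> f q"
proof -
  let ?S = "Poly_Mapping.keys p \<union> Poly_Mapping.keys q"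
  have "Poly_Mapping.keys (p + q) \<subseteq> ?S"
    by (rule keys_add)
  then show ?thesis
    using subst_superset[of ?S] by (simp add: lookup_add add algebra_simps sum.distrib)
qed

lemma subst_sum: "mpoly_subst \<kappa> f (sum g S) = (\<Sum>s\<in>S. mpoly_subst \<kappa> f (g s))"
  by (induction S rule: infinite_finite_induct) (auto simp: subst_add)

lemma subst_mult: "mpoly_subst \<kappa> f (p * q) = mpoly_subst \<kappa> f p * mpoly_subst \<kappa> f q"
proof -
  have s: "mpoly_subst \<kappa> f (Poly_Mapping.single m a * Poly_Mapping.single k b)
      = mpoly_subst \<kappa> f (Poly_Mapping.single m a) * mpoly_subst \<kappa> f (Poly_Mapping.single k b)" for m k a b
    by (simp add: mult_single subst_single mult lookup_add power_add prod.distrib)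
  let ?s = "\<lambda>p m. Poly_Mapping.single m (Poly_Mapping.lookup p m)"
  have "mpoly_subst \<kappa> f (p * q) =
     mpoly_subst \<kappa> f ((\<Sum>m\<in>Poly_Mapping.keys p. ?s p m) * (\<Sum>k\<in>Poly_Mapping.keys q. ?s q k))"
    by (simp flip: mpoly_eq_sum_single)
  also have "\<dots> = mpoly_subst \<kappa> f (\<Sum>m\<in>Poly_Mapping.keys p. ?s p m)
      * mpoly_subst \<kappa> f (\<Sum>k\<in>Poly_Mapping.keys q. ?s q k)"
    by (simp add: sum_product subst_sum s)
  also have "\<dots> = mpoly_subst \<kappa> f p * mpoly_subst \<kappa> f q"
    by (simp flip: mpoly_eq_sum_single)
  finally show ?thesis .
qed

lemma subst_uminus: "mpoly_subst \<kappa> f (- p) = - mpoly_subst \<kappa> f p"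
  using subst_add[of f p "- p"] by (simp add: eq_neg_iff_add_eq_0 add.commute)

end

interpretation real_hom: scalar_hom "id :: real \<Rightarrow> real"
  by unfold_locales auto

lemma mpoly_eval_simps:
  "mpoly_eval 0 x = 0" "mpoly_eval 1 x = 1"
  "mpoly_eval (p + q) x = mpoly_eval p x + mpoly_eval q x"
  "mpoly_eval (p * q) x = mpoly_eval p x * mpoly_eval q x"
  "mpoly_eval (- p) x = - mpoly_eval p x"
  "mpoly_eval (Poly_Mapping.single 0 c) x = c"
  by (simp_all add: mpoly_eval_eq_subst real_hom.subst_add real_hom.subst_mult real_hom.subst_uminus)

lemma mpoly_eval_nonzero_imp: "mpoly_eval b x \<noteq> 0 \<Longrightarrow> b \<noteq> 0"
  by (auto simp: mpoly_eval_simps)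

lemma mpoly_eval_single:
  "mpoly_eval (Poly_Mapping.single m c) x = c * (\<Prod>i\<in>UNIV. (x $ i) ^ Poly_Mapping.lookup m i)"
  by (simp add: mpoly_eval_eq_subst real_hom.subst_single)

lemma mpoly_eval_sum: "mpoly_eval (sum g S) x = (\<Sum>s\<in>S. mpoly_eval (g s) x)"
  by (simp add: mpoly_eval_eq_subst real_hom.subst_sum)

section \<open>Polynomials that vanish on an open set\<close>

text \<open>Induction on the variables: with the others fixed, the sum is a univariate polynomial in
  \<open>x i\<close> with infinitely many roots, so each of its coefficients vanishes, and these are
  sums of the same kind in fewer variables. The map \<open>e\<close> leaves open how exponent
  vectors are represented.\<close>

lemma polynomial_sum_vanishing_on_box:
  fixes e :: "'m \<Rightarrow> 'i \<Rightarrow> nat" and b :: "'m \<Rightarrow> real"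
  assumes "finite A" "finite M" "r > 0"
    and "\<And>x. (\<And>i. i \<in> A \<Longrightarrow> \<bar>x i - y i\<bar> < r) \<Longrightarrow> (\<Sum>m\<in>M. b m * (\<Prod>i\<in>A. x i ^ e m i)) = 0"
    and "inj_on (\<lambda>m. restrict (e m) A) M"
    and "m \<in> M"
  shows "b m = 0"
  using assms(1,2,4-)
proof (induction A arbitrary: M m rule: finite_induct)
  case empty
  then have "M = {m}"
    by (auto simp: inj_on_def)
  with empty.prems(2) show ?case by simp
next
  case (insert i A)
  \<comment> \<open>These terms make up the coefficient of the power \<open>e m i\<close> of the
    variable \<open>i\<close>.\<close>
  define Mk where "Mk = {m' \<in> M. e m' i = e m i}"
  have fin: "finite Mk" using insert.prems by (auto simp: Mk_def)
  have sub: "(\<Sum>m'\<in>Mk. b m' * (\<Prod>j\<in>A. x j ^ e m' j)) = 0"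
    if x: "\<And>j. j \<in> A \<Longrightarrow> \<bar>x j - y j\<bar> < r" for x
  proof -
    define q where "q = (\<Sum>m\<in>M. Polynomial.monom (b m * (\<Prod>j\<in>A. x j ^ e m j)) (e m i))"
    have "poly q s = 0" if "s \<in> {y i - r<..<y i + r}" for s
    proof -
      have "\<bar>(x(i := s)) j - y j\<bar> < r" if "j \<in> insert i A" for j
        using that x insert.hyps \<open>s \<in> _\<close> by auto
      then have "(\<Sum>m\<in>M. b m * (\<Prod>j\<in>insert i A. (x(i := s)) j ^ e m j)) = 0"
        by (rule insert.prems(2))
      moreover have "(\<Prod>j\<in>insert i A. (x(i := s)) j ^ e m j) = s ^ e m i * (\<Prod>j\<in>A. x j ^ e m j)" for m
      proof -
        have "(\<Prod>j\<in>A. (x(i := s)) j ^ e m j) = (\<Prod>j\<in>A. x j ^ e m j)"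
          by (rule prod.cong) (use insert.hyps in auto)
        then show ?thesis
          by (simp add: prod.insert[OF insert.hyps])
      qed
      ultimately show ?thesis
        by (simp add: q_def poly_sum Polynomial.poly_monom mult_ac)
    qed
    then have "{y i - r<..<y i + r} \<subseteq> {s. poly q s = 0}" by auto
    moreover have "infinite {y i - r<..<y i + r}"
      using \<open>r > 0\<close> by (intro infinite_Ioo) auto
    ultimately have "q = 0"
      using poly_roots_finite finite_subset by blast
    then have "0 = Polynomial.coeff q (e m i)" by simp
    also have "\<dots> = (\<Sum>m'\<in>M. if e m' i = e m i then b m' * (\<Prod>j\<in>A. x j ^ e m' j) else 0)"
      by (simp add: q_def Polynomial.coeff_sum)
    also have "\<dots> = (\<Sum>m'\<in>Mk. b m' * (\<Prod>j\<in>A. x j ^ e m' j))"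
      unfolding Mk_def by (subst sum.inter_filter) (use insert.prems in auto)
    finally show ?thesis by simp
  qed
  have "inj_on (\<lambda>m. restrict (e m) A) Mk"
  proof (rule inj_onI)
    fix m1 m2 assume m: "m1 \<in> Mk" "m2 \<in> Mk" "restrict (e m1) A = restrict (e m2) A"
    then have "e m1 j = e m2 j" if "j \<in> insert i A" for j
    proof (cases "j = i")
      case True
      then show ?thesis using m by (simp add: Mk_def)
    next
      case False
      then have "j \<in> A" using that by simp
      then show ?thesis using fun_cong[OF m(3), of j] by simp
    qed
    then have "restrict (e m1) (insert i A) = restrict (e m2) (insert i A)"
      by (auto simp: restrict_def)
    then show "m1 = m2"
      by (rule inj_onD[OF insert.prems(3)]) (use m(1,2) in \<open>simp_all add: Mk_def\<close>)
  qed
  moreover have "m \<in> Mk" using insert.prems by (simp add: Mk_def)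
  ultimately show ?case
    using insert.IH[OF fin sub] by blast
qed

lemma open_contains_cube:
  fixes y :: "real ^ 'n::finite"
  assumes "open U" "y \<in> U"
  obtains r where "r > 0" "\<And>z. (\<And>i. \<bar>z $ i - y $ i\<bar> < r) \<Longrightarrow> z \<in> U"
proof -
  obtain r where r: "r > 0" "ball y r \<subseteq> U"
    using assms open_contains_ball by blast
  \<comment> \<open>The extra 1 makes the sum of \<open>CARD('n)\<close> copies of \<open>r'\<close>
    strictly less than \<open>r\<close>; that sum bounds the norm through the absolute
    coordinates.\<close>
  define r' where "r' = r / (CARD('n) + 1)"
  have "z \<in> U" if "\<And>i. \<bar>z $ i - y $ i\<bar> < r'" for z
  proof -
    have "norm (z - y) \<le> (\<Sum>i\<in>UNIV. \<bar>(z - y) $ i\<bar>)"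
      by (rule norm_le_l1_cart)
    also have "\<dots> \<le> (\<Sum>i\<in>(UNIV::'n set). r')"
      using that by (intro sum_mono) (auto intro: less_imp_le)
    also have "\<dots> < r"
    proof -
      have "real CARD('n) * r < r * (real CARD('n) + 1)"
        using r by (simp add: algebra_simps)
      then show ?thesis
        by (simp add: r'_def pos_divide_less_eq add.commute)
    qed
    finally have "z \<in> ball y r"
      by (simp add: dist_norm norm_minus_commute)
    then show ?thesis using r(2) by blast
  qed
  moreover have "r' > 0" using r by (simp add: r'_def)
  ultimately show ?thesis using that by blast
qed

lemma mpoly_eval_nonzero_on_open:
  fixes p :: "'n::finite real_mpoly"
  assumes "p \<noteq> 0" "open U" "U \<noteq> {}"
  obtains x where "x \<in> U" "mpoly_eval p x \<noteq> 0"
proof -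
  have False if z: "\<And>x. x \<in> U \<Longrightarrow> mpoly_eval p x = 0"
  proof -
    obtain y where "y \<in> U" using assms by blast
    then obtain r where r: "r > 0" "\<And>z. (\<And>i. \<bar>z $ i - y $ i\<bar> < r) \<Longrightarrow> z \<in> U"
      using open_contains_cube[OF assms(2)] by metis
    have inU: "(\<chi> i. x i) \<in> U" if "\<And>i. \<bar>x i - y $ i\<bar> < r" for x :: "'n \<Rightarrow> real"
      by (rule r(2)) (use that in simp)
    have "Poly_Mapping.lookup p m = 0" if "m \<in> Poly_Mapping.keys p" for m
    proof (rule polynomial_sum_vanishing_on_box[where A = UNIV and r = r and y = "\<lambda>i. y $ i"
          and e = Poly_Mapping.lookup and M = "Poly_Mapping.keys p" and m = m])
      show "inj_on (\<lambda>m. restrict (Poly_Mapping.lookup m) UNIV) (Poly_Mapping.keys p)"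
        by (rule inj_onI) (simp add: restrict_UNIV lookup_inject)
      show "(\<Sum>m\<in>Poly_Mapping.keys p. Poly_Mapping.lookup p m * (\<Prod>i\<in>UNIV. x i ^ Poly_Mapping.lookup m i)) = 0"
        if "\<And>i. i \<in> UNIV \<Longrightarrow> \<bar>x i - y $ i\<bar> < r" for x
        using z[OF inU, of x] that by (simp add: mpoly_eval_def)
    qed (use r that in auto)
    then have "p = 0"
      by (intro poly_mapping_eqI) (metis in_keys_iff lookup_zero)
    with \<open>p \<noteq> 0\<close> show False by simp
  qed
  with that show ?thesis by blast
qed

section \<open>Linear dependence by counting monomials\<close>

text \<open>Gaussian elimination on the equations \<open>j\<close> with unknowns \<open>c i\<close>:
  an equation with a nonzero coefficient eliminates one unknown, so each equation costs at most
  one.\<close>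

lemma homogeneous_system_solution:
  fixes B :: "'i \<Rightarrow> 'j \<Rightarrow> 'a::field"
  assumes "finite J" "finite I" "card J < card I"
  shows "\<exists>c. (\<exists>i\<in>I. c i \<noteq> 0) \<and> (\<forall>j\<in>J. (\<Sum>i\<in>I. c i * B i j) = 0)"
  using assms
proof (induction J arbitrary: I B rule: finite_induct)
  case empty
  then have "I \<noteq> {}" by auto
  then show ?case by (auto intro!: exI[of _ "\<lambda>_. 1"])
next
  case (insert j J)
  show ?case
  proof (cases "\<forall>i\<in>I. B i j = 0")
    case True
    have "card J < card I" using insert by simp
    from insert.IH[OF \<open>finite I\<close> this, of B] True show ?thesis by auto
  next
    case False
    then obtain i0 where i0: "i0 \<in> I" "B i0 j \<noteq> 0" by auto
    define I' where "I' = I - {i0}"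
    have I': "finite I'" "card J < card I'" "i0 \<notin> I'" "I = insert i0 I'"
      using insert i0 by (auto simp: I'_def)
    obtain c where c: "\<exists>i\<in>I'. c i \<noteq> 0"
      "\<And>k. k \<in> J \<Longrightarrow> (\<Sum>i\<in>I'. c i * (B i k - B i j / B i0 j * B i0 k)) = 0"
      using insert.IH[OF I'(1,2), of "\<lambda>i k. B i k - B i j / B i0 j * B i0 k"] by auto
    \<comment> \<open>The pivot value is forced by equation \<open>j\<close>; substituting it turns
      the other equations into the reduced ones solved by \<open>c\<close>.\<close>
    define c' where "c' = c(i0 := - (\<Sum>i\<in>I'. c i * B i j) / B i0 j)"
    have "(\<Sum>i\<in>I. c' i * B i k) = (\<Sum>i\<in>I'. c i * B i k) - (\<Sum>i\<in>I'. c i * B i j) / B i0 j * B i0 k" for k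
    proof -
      have "(\<Sum>i\<in>I'. c' i * B i k) = (\<Sum>i\<in>I'. c i * B i k)"
        using I' by (intro sum.cong) (auto simp: c'_def)
      then show ?thesis using I' by (simp add: c'_def)
    qed
    moreover have "(\<Sum>i\<in>I'. c i * (B i k - B i j / B i0 j * B i0 k)) =
        (\<Sum>i\<in>I'. c i * B i k) - (\<Sum>i\<in>I'. c i * B i j) / B i0 j * B i0 k" for k
      by (simp add: algebra_simps sum_subtractf sum_distrib_left sum_divide_distrib)
    ultimately have "\<forall>k\<in>insert j J. (\<Sum>i\<in>I. c' i * B i k) = 0"
      using c(2) i0 by auto
    moreover have "\<exists>i\<in>I. c' i \<noteq> 0"
      using c(1) I' by (auto simp: c'_def)
    ultimately show ?thesis by blast
  qed
qed

text \<open>Bounding each exponent separately, rather than the total degree, makes the number of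
  monomials a power.\<close>

definition exponent_box :: "nat \<Rightarrow> ('i::finite \<Rightarrow> nat) set" where
  "exponent_box D = {m. \<forall>i. m i \<le> D}"

lemma exponent_box_eq_PiE: "exponent_box D = (\<Pi>\<^sub>E i\<in>UNIV. {..D})"
  by (auto simp: exponent_box_def PiE_def Pi_def extensional_def)

lemma finite_exponent_box [simp]: "finite (exponent_box D)"
  by (simp add: exponent_box_eq_PiE finite_PiE)

lemma card_exponent_box: "card (exponent_box D :: ('i::finite \<Rightarrow> nat) set) = (D + 1) ^ CARD('i)"
  by (simp add: exponent_box_eq_PiE card_PiE)

text \<open>The coefficients are existential because the counting argument only asks that the
  functions lie in the span of these monomials.\<close>

definition box_polynomial :: "('i::finite \<Rightarrow> 'w \<Rightarrow> real) \<Rightarrow> nat \<Rightarrow> ('w \<Rightarrow> real) \<Rightarrow> bool" where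
  "box_polynomial v D g \<longleftrightarrow> (\<exists>b. \<forall>w. g w = (\<Sum>m\<in>exponent_box D. b m * (\<Prod>i\<in>UNIV. v i w ^ m i)))"

lemma box_polynomial_monomial:
  assumes "m \<in> exponent_box D"
  shows "box_polynomial v D (\<lambda>w. \<Prod>i\<in>UNIV. v i w ^ m i)"
  unfolding box_polynomial_def
  by (intro exI[of _ "\<lambda>k. if k = m then 1 else 0"]) (use assms in \<open>simp add: if_distrib[of "\<lambda>x. x * _"] cong: if_cong\<close>)

lemma box_polynomial_add:
  assumes "box_polynomial v D f" "box_polynomial v D g"
  shows "box_polynomial v D (\<lambda>w. f w + g w)"
proof -
  from assms obtain b c where "\<forall>w. f w = (\<Sum>m\<in>exponent_box D. b m * (\<Prod>i\<in>UNIV. v i w ^ m i))"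
    "\<forall>w. g w = (\<Sum>m\<in>exponent_box D. c m * (\<Prod>i\<in>UNIV. v i w ^ m i))"
    unfolding box_polynomial_def by blast
  then show ?thesis
    unfolding box_polynomial_def
    by (intro exI[of _ "\<lambda>m. b m + c m"]) (simp add: algebra_simps sum.distrib)
qed

lemma box_polynomial_scale:
  assumes "box_polynomial v D f"
  shows "box_polynomial v D (\<lambda>w. c * f w)"
proof -
  from assms obtain b where "\<forall>w. f w = (\<Sum>m\<in>exponent_box D. b m * (\<Prod>i\<in>UNIV. v i w ^ m i))"
    unfolding box_polynomial_def by blast
  then show ?thesis
    unfolding box_polynomial_def
    by (intro exI[of _ "\<lambda>m. c * b m"]) (simp add: sum_distrib_left mult.assoc)
qed

lemma box_polynomial_const: "box_polynomial v D (\<lambda>w. c)"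
  using box_polynomial_scale[OF box_polynomial_monomial[of "\<lambda>_. 0" D v], of c]
  by (simp add: exponent_box_def)

lemma box_polynomial_sum:
  "(\<And>s. s \<in> S \<Longrightarrow> box_polynomial v D (f s)) \<Longrightarrow> box_polynomial v D (\<lambda>w. \<Sum>s\<in>S. f s w)"
  by (induction S rule: infinite_finite_induct) (auto intro: box_polynomial_const box_polynomial_add)

lemma box_polynomial_mult:
  assumes "box_polynomial v D f" "box_polynomial v E g"
  shows "box_polynomial v (D + E) (\<lambda>w. f w * g w)"
proof -
  from assms obtain b c where bc: "\<forall>w. f w = (\<Sum>m\<in>exponent_box D. b m * (\<Prod>i\<in>UNIV. v i w ^ m i))"
    "\<forall>w. g w = (\<Sum>m\<in>exponent_box E. c m * (\<Prod>i\<in>UNIV. v i w ^ m i))"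
    unfolding box_polynomial_def by blast
  have eq: "(\<lambda>w. f w * g w) = (\<lambda>w. \<Sum>m\<in>exponent_box D. \<Sum>k\<in>exponent_box E.
      (b m * c k) * (\<Prod>i\<in>UNIV. v i w ^ (m i + k i)))"
    by (simp only: bc sum_product power_add prod.distrib mult_ac)
  have mk: "(\<lambda>i. m i + k i) \<in> exponent_box (D + E)" if "m \<in> exponent_box D" "k \<in> exponent_box E" for m k :: "'a \<Rightarrow> nat"
    using that by (auto simp: exponent_box_def intro: add_mono)
  show ?thesis
    unfolding eq
    by (intro box_polynomial_sum box_polynomial_scale box_polynomial_monomial mk)
qed

text \<open>Multiplication by the constant 1, counted with the bound \<open>E - D\<close>.\<close>

lemma box_polynomial_mono:
  assumes "box_polynomial v D f" "D \<le> E"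
  shows "box_polynomial v E f"
  using box_polynomial_mult[OF assms(1) box_polynomial_const[of v "E - D" 1]] assms(2) by simp

lemma box_polynomial_power: "box_polynomial v D f \<Longrightarrow> box_polynomial v (a * D) (\<lambda>w. f w ^ a)"
  by (induction a) (auto intro: box_polynomial_const box_polynomial_mult)

lemma box_polynomial_prod:
  assumes "finite S" "\<And>s. s \<in> S \<Longrightarrow> box_polynomial v D (f s)"
  shows "box_polynomial v (card S * D) (\<lambda>w. \<Prod>s\<in>S. f s w)"
  using assms by (induction S rule: finite_induct) (auto intro: box_polynomial_const box_polynomial_mult)

text \<open>All \<open>f s\<close> lie in the span of \<open>(D + 1) ^ CARD('i)\<close> monomials,
  so the coefficient vectors of a larger family are linearly dependent.\<close>

lemma box_polynomials_dependent:
  fixes v :: "'i::finite \<Rightarrow> 'w \<Rightarrow> real"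
  assumes "finite I" "(D + 1) ^ CARD('i) < card I" "\<And>s. s \<in> I \<Longrightarrow> box_polynomial v D (f s)"
  shows "\<exists>c. (\<exists>s\<in>I. c s \<noteq> 0) \<and> (\<forall>w. (\<Sum>s\<in>I. c s * f s w) = 0)"
proof -
  from assms(3) obtain b where
    b: "\<And>s w. s \<in> I \<Longrightarrow> f s w = (\<Sum>m\<in>exponent_box D. b s m * (\<Prod>i\<in>UNIV. v i w ^ m i))"
    unfolding box_polynomial_def by metis
  obtain c where c: "\<exists>s\<in>I. c s \<noteq> 0" "\<And>m. m \<in> exponent_box D \<Longrightarrow> (\<Sum>s\<in>I. c s * b s m) = 0"
    using homogeneous_system_solution[of "exponent_box D :: ('i \<Rightarrow> nat) set" I b] assms
    by (auto simp: card_exponent_box)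
  have "(\<Sum>s\<in>I. c s * f s w) = 0" for w
  proof -
    have "(\<Sum>s\<in>I. c s * f s w) =
        (\<Sum>s\<in>I. \<Sum>m\<in>exponent_box D. c s * b s m * (\<Prod>i\<in>UNIV. v i w ^ m i))"
      by (simp add: b sum_distrib_left mult.assoc)
    also have "\<dots> = (\<Sum>m\<in>exponent_box D. (\<Sum>s\<in>I. c s * b s m) * (\<Prod>i\<in>UNIV. v i w ^ m i))"
      by (subst sum.swap) (simp add: sum_distrib_right)
    finally show ?thesis using c(2) by simp
  qed
  with c(1) show ?thesis by blast
qed

lemma box_polynomial_mpoly_eval:
  fixes p :: "'n::finite real_mpoly" and u :: "'w \<Rightarrow> real ^ 'n"
  assumes u: "\<And>j. box_polynomial v 1 (\<lambda>w. u w $ j)"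
  shows "\<exists>D. box_polynomial v D (\<lambda>w. mpoly_eval p (u w))"
proof -
  \<comment> \<open>The sum of all exponents occurring in \<open>p\<close> is a crude bound for each
    of them.\<close>
  define E where "E = (\<Sum>m\<in>Poly_Mapping.keys p. \<Sum>i\<in>UNIV. Poly_Mapping.lookup m i)"
  have E: "Poly_Mapping.lookup m i \<le> E" if "m \<in> Poly_Mapping.keys p" for m i
  proof -
    have "Poly_Mapping.lookup m i \<le> (\<Sum>i\<in>UNIV. Poly_Mapping.lookup m i)"
      by (rule member_le_sum) auto
    also have "\<dots> \<le> E" unfolding E_def
      by (rule member_le_sum[where f = "\<lambda>m. \<Sum>i\<in>UNIV. Poly_Mapping.lookup m i"]) (use that in auto)
    finally show ?thesis .
  qed
  have "box_polynomial v E (\<lambda>w. (u w $ i) ^ Poly_Mapping.lookup m i)" if "m \<in> Poly_Mapping.keys p" for m i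
    using box_polynomial_mono[OF box_polynomial_power[OF u, of "Poly_Mapping.lookup m i"], of E i]
      E[OF that, of i] by simp
  then have "box_polynomial v (CARD('n) * E) (\<lambda>w. mpoly_eval p (u w))"
    unfolding mpoly_eval_def
    by (intro box_polynomial_sum box_polynomial_scale box_polynomial_prod) auto
  then show ?thesis ..
qed

section \<open>Algebraic dependence\<close>

lemma prod_UNIV_Plus:
  fixes f :: "'a::finite + 'b::finite \<Rightarrow> 'c::comm_monoid_mult"
  shows "(\<Prod>i\<in>UNIV. f i) = (\<Prod>i\<in>UNIV. f (Inl i)) * (\<Prod>i\<in>UNIV. f (Inr i))"
proof -
  have "(\<Prod>i\<in>UNIV. f i) = (\<Prod>i\<in>range Inl \<union> range Inr. f i)"
    by (simp add: UNIV_sum)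
  also have "\<dots> = (\<Prod>i\<in>range Inl. f i) * (\<Prod>i\<in>range Inr. f i)"
    by (rule prod.union_disjoint) auto
  also have "(\<Prod>i\<in>range Inl. f i) = (\<Prod>i\<in>UNIV. f (Inl i))"
    by (subst prod.reindex) auto
  also have "(\<Prod>i\<in>range Inr. f i) = (\<Prod>i\<in>UNIV. f (Inr i))"
    by (subst prod.reindex) auto
  finally show ?thesis .
qed

lemma mpoly_eval_differentiable: "mpoly_eval p differentiable (at x)"
proof -
  have "(\<lambda>x. \<Prod>i\<in>S. (x $ i) ^ m i) differentiable (at x)" if "finite S" for S and m :: "'a \<Rightarrow> nat" and x :: "real ^ 'a"
    using that
  proof (induction S)
    case (insert i S)
    have "(\<lambda>x::real^'a. (x $ i) ^ m i) differentiable (at x)"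
      by (intro differentiable_power bounded_linear_imp_differentiable bounded_linear_vec_nth)
    with insert show ?case by simp
  qed simp
  then have "(\<lambda>x. \<Sum>m\<in>Poly_Mapping.keys p. Poly_Mapping.lookup p m * (\<Prod>i\<in>UNIV. (x $ i) ^ Poly_Mapping.lookup m i))
      differentiable (at x)"
    by (intro differentiable_sum differentiable_mult ballI) auto
  then show ?thesis by (simp add: mpoly_eval_def[abs_def])
qed

lemma differentiable_at_vecI:
  fixes f :: "real ^ 'm::finite \<Rightarrow> real ^ 'n::finite"
  assumes "\<And>i. (\<lambda>x. f x $ i) differentiable (at x)"
  shows "f differentiable (at x)"
proof -
  have "(\<lambda>x. f x \<bullet> b) differentiable (at x)" if "b \<in> Basis" for b
    using that assms by (auto simp: Basis_vec_def inner_axis)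
  then show ?thesis
    using differentiable_componentwise_within[of f x UNIV] by blast
qed

text \<open>The inverse of the Jacobian matrix is a right inverse of the derivative, as Sussmann's
  open mapping theorem requires.\<close>

lemma nonsingular_imp_interior_image:
  fixes f :: "real ^ 'n::finite \<Rightarrow> real ^ 'n"
  assumes diff: "\<And>x. f differentiable (at x)" and det: "det (jacobian f (at x)) \<noteq> 0"
    and "open U" "x \<in> U"
  shows "f x \<in> interior (f ` U)"
proof -
  let ?D = "frechet_derivative f (at x)"
  have D: "(f has_derivative ?D) (at x)"
    using diff frechet_derivative_works by blast
  then have lin: "linear ?D" by (rule has_derivative_linear)
  have "invertible (matrix ?D)"
    using det by (simp add: jacobian_def invertible_det_nz)
  then obtain B where B: "matrix ?D ** B = mat 1"
    unfolding invertible_def by blast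
  show ?thesis
  proof (rule sussmann_open_mapping[OF \<open>open U\<close> _ \<open>x \<in> U\<close> D])
    show "continuous_on U f"
      by (intro differentiable_imp_continuous_on differentiable_at_imp_differentiable_on) (use diff in auto)
    show "bounded_linear ((*v) B)"
      by (rule matrix_vector_mul_bounded_linear)
    show "?D \<circ> (*v) B = id"
    proof
      fix v
      have "?D (B *v v) = matrix ?D *v (B *v v)"
        using lin by (simp add: matrix_works)
      also have "\<dots> = v" by (simp add: matrix_vector_mul_assoc B)
      finally show "(?D \<circ> (*v) B) v = id v" by simp
    qed
    show "x \<in> interior U" using \<open>open U\<close> \<open>x \<in> U\<close> by (simp add: interior_open)
  qed auto
qed

text \<open>The nonvanishing Jacobian enters the algebra through this local openness.\<close>

locale open_rational_map =
  fixes F :: "real ^ 'n::finite \<Rightarrow> real ^ 'n" and P Q :: "'n \<Rightarrow> 'n real_mpoly"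
  assumes Q_nonzero: "mpoly_eval (Q i) x \<noteq> 0"
    and F_eq: "F x $ i = mpoly_eval (P i) x / mpoly_eval (Q i) x"
    and interior_image: "open U \<Longrightarrow> x \<in> U \<Longrightarrow> F x \<in> interior (F ` U)"
begin

text \<open>The linear form, the t_i and the F_i are 2n + 1 functions of 2n real coordinates, so for
  large degree their monomials outnumber the functions spanning them. In \<open>m\<close>,
  \<open>Inl\<close> indexes the powers of \<open>t\<close> and \<open>Inr\<close> those of
  \<open>F\<close>.\<close>

lemma algebraic_dependence:
  "\<exists>T b. (\<exists>a\<le>T. \<exists>m\<in>exponent_box T. b a m \<noteq> 0) \<and>
     (\<forall>t x. (\<Sum>a\<le>T. \<Sum>m\<in>exponent_box T. b a m * (\<Sum>i\<in>UNIV. t $ i * x $ i) ^ a *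
        ((\<Prod>i\<in>UNIV. (t $ i) ^ m (Inl i)) * (\<Prod>i\<in>UNIV. (F x $ i) ^ m (Inr i)))) = 0)"
proof -
  define v :: "'n + 'n \<Rightarrow> (real ^ 'n) \<times> (real ^ 'n) \<Rightarrow> real"
    where "v = case_sum (\<lambda>i w. fst w $ i) (\<lambda>i w. snd w $ i)"
  have coord: "box_polynomial v 1 (v i)" for i
  proof -
    have "(\<Prod>j\<in>UNIV. v j w ^ (if j = i then 1 else 0)) = v i w" for w
      by (subst prod.cong[OF refl, of _ _ "\<lambda>j. if j = i then v j w else 1"]) auto
    then show ?thesis
      using box_polynomial_monomial[of "\<lambda>j. if j = i then 1 else 0" 1 v] by (simp add: exponent_box_def)
  qed
  have fst: "box_polynomial v 1 (\<lambda>w. fst w $ i)" and snd: "box_polynomial v 1 (\<lambda>w. snd w $ i)" for i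
    using coord[of "Inl i"] coord[of "Inr i"] by (simp_all add: v_def)
  have lin: "box_polynomial v 2 (\<lambda>w. \<Sum>i\<in>UNIV. fst w $ i * snd w $ i)"
    using box_polynomial_mult[OF fst snd] by (intro box_polynomial_sum) (simp add: numeral_2_eq_2)
  have "\<exists>D. box_polynomial v D (\<lambda>w. mpoly_eval p (snd w))" for p :: "'n real_mpoly"
    using box_polynomial_mpoly_eval snd by blast
  then obtain dg where dg: "\<And>p :: 'n real_mpoly. box_polynomial v (dg p) (\<lambda>w. mpoly_eval p (snd w))"
    by metis
  define E where "E = (\<Sum>i\<in>UNIV. dg (P i) + dg (Q i))"
  have "dg (P i) + dg (Q i) \<le> E" for i
    unfolding E_def by (rule member_le_sum[where f = "\<lambda>i. dg (P i) + dg (Q i)"]) auto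
  then have "dg (P i) \<le> E" "dg (Q i) \<le> E" for i
    by (meson add_leD1 add_leD2)+
  then have PQ: "box_polynomial v E (\<lambda>w. mpoly_eval (P i) (snd w))"
      "box_polynomial v E (\<lambda>w. mpoly_eval (Q i) (snd w))" for i
    using box_polynomial_mono[OF dg] by blast+
  \<comment> \<open>After multiplication by the denominators, \<open>(T + 1) ^ (2n + 1)\<close> monomials lie in a space spanned
    by \<open>(cT + 1) ^ 2n\<close> functions, which is fewer for \<open>T = c ^ 2n\<close>.\<close>
  define c where "c = 2 + CARD('n) + CARD('n) * E"
  define N where "N = 2 * CARD('n)"
  define T where "T = c ^ N"
  define I where "I = {..T} \<times> (exponent_box T :: ('n + 'n \<Rightarrow> nat) set)"
  \<comment> \<open>The monomial with exponents \<open>(a, m)\<close>, multiplied by the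
    \<open>T\<close>-th powers of all \<open>Q i\<close>; on \<open>I\<close> the exponents of
    \<open>F\<close> are at most \<open>T\<close>, so all denominators cancel.\<close>
  define f :: "nat \<times> ('n + 'n \<Rightarrow> nat) \<Rightarrow> (real ^ 'n) \<times> (real ^ 'n) \<Rightarrow> real" where
    "f = (\<lambda>(a, m) w. (\<Sum>i\<in>UNIV. fst w $ i * snd w $ i) ^ a *
        ((\<Prod>i\<in>UNIV. (fst w $ i) ^ m (Inl i)) *
         (\<Prod>i\<in>UNIV. mpoly_eval (P i) (snd w) ^ m (Inr i) * mpoly_eval (Q i) (snd w) ^ (T - m (Inr i)))))"
  \<comment> \<open>The power of the linear form contributes \<open>2 * T\<close>, the powers of
    \<open>t\<close> contribute \<open>n * T\<close> and the cleared powers of \<open>F\<close>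
    contribute \<open>n * E * T\<close>; \<open>c\<close> collects these factors.\<close>
  have f_box: "box_polynomial v (c * T) (f s)" if "s \<in> I" for s
  proof -
    obtain a m where s: "s = (a, m)" "a \<le> T" "\<And>i. m i \<le> T"
      using \<open>s \<in> I\<close> by (cases s) (auto simp: I_def exponent_box_def)
    have "box_polynomial v (T * 2) (\<lambda>w. (\<Sum>i\<in>UNIV. fst w $ i * snd w $ i) ^ a)"
      using box_polynomial_mono[OF box_polynomial_power[OF lin, of a]] s by simp
    moreover have "box_polynomial v T (\<lambda>w. (fst w $ i) ^ m (Inl i))" for i
      using box_polynomial_mono[OF box_polynomial_power[OF fst, of "m (Inl i)"]] s by simp
    then have "box_polynomial v (CARD('n) * T) (\<lambda>w. \<Prod>i\<in>UNIV. (fst w $ i) ^ m (Inl i))"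
      by (intro box_polynomial_prod) auto
    moreover have "box_polynomial v (T * E)
        (\<lambda>w. mpoly_eval (P i) (snd w) ^ m (Inr i) * mpoly_eval (Q i) (snd w) ^ (T - m (Inr i)))" for i
    proof -
      have "m (Inr i) * E + (T - m (Inr i)) * E = T * E"
        using s(3)[of "Inr i"] by (metis add_mult_distrib le_add_diff_inverse)
      then show ?thesis
        using box_polynomial_mult[OF box_polynomial_power[OF PQ(1), of "m (Inr i)"]
            box_polynomial_power[OF PQ(2), of "T - m (Inr i)"], of i i] by simp
    qed
    then have "box_polynomial v (CARD('n) * (T * E)) (\<lambda>w. \<Prod>i\<in>UNIV.
        mpoly_eval (P i) (snd w) ^ m (Inr i) * mpoly_eval (Q i) (snd w) ^ (T - m (Inr i)))"
      by (intro box_polynomial_prod) auto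
    ultimately have "box_polynomial v (T * 2 + (CARD('n) * T + CARD('n) * (T * E))) (f s)"
      unfolding s f_def prod.case by (intro box_polynomial_mult)
    moreover have "T * 2 + (CARD('n) * T + CARD('n) * (T * E)) = c * T"
      by (simp add: c_def algebra_simps)
    ultimately show ?thesis by simp
  qed
  \<comment> \<open>The factor \<open>c ^ N\<close> equals \<open>T\<close>, which is less than the
    extra factor \<open>T + 1\<close> that the exponent of the linear form contributes to
    \<open>card I\<close>.\<close>
  have "c * T + 1 \<le> c * (T + 1)" by (simp add: c_def)
  then have "(c * T + 1) ^ N \<le> (c * (T + 1)) ^ N" by (rule power_mono) simp
  also have "\<dots> = T * (T + 1) ^ N" by (simp only: power_mult_distrib T_def)
  also have "\<dots> < (T + 1) * (T + 1) ^ N" by simp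
  also have "\<dots> = card I"
    by (simp add: I_def card_cartesian_product card_exponent_box N_def mult_2)
  finally have "(c * T + 1) ^ CARD('n + 'n) < card I" by (simp add: N_def mult_2)
  then obtain b where b: "\<exists>s\<in>I. b s \<noteq> 0" "\<And>w. (\<Sum>s\<in>I. b s * f s w) = 0"
    using box_polynomials_dependent[of I "c * T" v f] f_box by (auto simp: I_def)
  have "(\<Sum>a\<le>T. \<Sum>m\<in>exponent_box T. b (a, m) * (\<Sum>i\<in>UNIV. t $ i * x $ i) ^ a *
        ((\<Prod>i\<in>UNIV. (t $ i) ^ m (Inl i)) * (\<Prod>i\<in>UNIV. (F x $ i) ^ m (Inr i)))) = 0" for t x
  proof -
    let ?g = "\<lambda>a m. b (a, m) * (\<Sum>i\<in>UNIV. t $ i * x $ i) ^ a *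
        ((\<Prod>i\<in>UNIV. (t $ i) ^ m (Inl i)) * (\<Prod>i\<in>UNIV. (F x $ i) ^ m (Inr i)))"
    \<comment> \<open>This common denominator vanishes nowhere, so the relation between the cleared
      monomials can be divided by it at every point.\<close>
    define G where "G = (\<Prod>i\<in>UNIV. mpoly_eval (Q i) x ^ T)"
    have G: "G \<noteq> 0" by (simp add: G_def Q_nonzero)
    have "G * (\<Prod>i\<in>UNIV. (F x $ i) ^ m (Inr i)) =
        (\<Prod>i\<in>UNIV. mpoly_eval (P i) x ^ m (Inr i) * mpoly_eval (Q i) x ^ (T - m (Inr i)))"
      if "m \<in> exponent_box T" for m :: "'n + 'n \<Rightarrow> nat"
      unfolding G_def prod.distrib[symmetric]
    proof (rule prod.cong[OF refl])
      fix i
      have "m (Inr i) \<le> T" using that by (simp add: exponent_box_def)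
      then have "mpoly_eval (Q i) x ^ T = mpoly_eval (Q i) x ^ m (Inr i) * mpoly_eval (Q i) x ^ (T - m (Inr i))"
        by (simp flip: power_add)
      then show "mpoly_eval (Q i) x ^ T * (F x $ i) ^ m (Inr i)
          = mpoly_eval (P i) x ^ m (Inr i) * mpoly_eval (Q i) x ^ (T - m (Inr i))"
        by (simp add: F_eq power_divide Q_nonzero)
    qed
    then have "G * ?g a m = b (a, m) * f (a, m) (t, x)" if "m \<in> exponent_box T" for a m
      using that by (simp add: f_def mult.left_commute[of G] mult.assoc)
    then have "G * (\<Sum>a\<le>T. \<Sum>m\<in>exponent_box T. ?g a m) = (\<Sum>a\<le>T. \<Sum>m\<in>exponent_box T. b (a, m) * f (a, m) (t, x))"
      by (simp only: sum_distrib_left) (intro sum.cong refl, simp)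
    also have "\<dots> = (\<Sum>s\<in>I. b s * f s (t, x))"
      by (simp add: I_def sum.cartesian_product)
    finally show ?thesis using b(2) G by simp
  qed
  moreover have "\<exists>a\<le>T. \<exists>m\<in>exponent_box T. b (a, m) \<noteq> 0"
    using b(1) by (auto simp: I_def)
  ultimately show ?thesis
    by (intro exI[of _ T] exI[of _ "\<lambda>a m. b (a, m)"]) blast
qed

end

section \<open>A primitive linear form\<close>

context open_rational_map
begin

text \<open>As the range of \<open>F\<close> contains an open set, the pairs \<open>(t, F x)\<close>
  fill a cube around \<open>(0, F 0)\<close>, on which only the zero polynomial vanishes. Thus
  \<open>t\<close> and \<open>F\<close> are algebraically independent.\<close>

lemma no_relation_in_t_and_F:
  fixes b :: "('n + 'n \<Rightarrow> nat) \<Rightarrow> real"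
  assumes "\<And>t x. (\<Sum>m\<in>exponent_box T. b m *
        ((\<Prod>i\<in>UNIV. (t $ i) ^ m (Inl i)) * (\<Prod>i\<in>UNIV. (F x $ i) ^ m (Inr i)))) = 0"
    and "m \<in> exponent_box T"
  shows "b m = 0"
proof -
  have "F 0 \<in> interior (range F)" using interior_image[of UNIV 0] by simp
  then obtain r where r: "r > 0" "\<And>z. (\<And>i. \<bar>z $ i - F 0 $ i\<bar> < r) \<Longrightarrow> z \<in> interior (range F)"
    using open_contains_cube[OF open_interior] by metis
  show ?thesis
  proof (rule polynomial_sum_vanishing_on_box[where A = UNIV and r = r and e = "\<lambda>m. m"
        and y = "case_sum (\<lambda>_. 0) (\<lambda>i. F 0 $ i)" and M = "exponent_box T" and m = m])
    fix z :: "'n + 'n \<Rightarrow> real"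
    assume z: "\<And>i. i \<in> UNIV \<Longrightarrow> \<bar>z i - (case i of Inl _ \<Rightarrow> 0 | Inr i \<Rightarrow> F 0 $ i)\<bar> < r"
    have "(\<chi> i. z (Inr i)) \<in> interior (range F)"
      by (rule r(2)) (use z[of "Inr _"] in simp)
    then obtain x where x: "(\<chi> i. z (Inr i)) = F x"
      using interior_subset by blast
    have "F x $ i = z (Inr i)" for i
      by (simp flip: x)
    then show "(\<Sum>m\<in>exponent_box T. b m * (\<Prod>i\<in>UNIV. z i ^ m i)) = 0"
      using assms(1)[of "\<chi> i. z (Inl i)" x] by (simp add: prod_UNIV_Plus)
  qed (use r assms(2) in \<open>auto intro!: inj_onI simp: restrict_UNIV\<close>)
qed

text \<open>\<open>C\<close> holds the coefficients of the relation at \<open>t = c\<close>, and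
  \<open>R j\<close> those of its derivative by the \<open>j\<close>-th coordinate of
  \<open>t\<close>. The second clause is linear in \<open>x $ j\<close>, and the third makes it
  solvable in the function field.\<close>

lemma primitive_linear_form:
  "\<exists>c A C R.
     (\<forall>x. (\<Sum>a\<le>A. mpoly_eval (C a) (F x) * (\<Sum>i\<in>UNIV. c $ i * x $ i) ^ a) = 0) \<and>
     (\<forall>x j. (\<Sum>a\<le>A. real a * mpoly_eval (C a) (F x) * (\<Sum>i\<in>UNIV. c $ i * x $ i) ^ (a - 1)) * x $ j +
        (\<Sum>a\<le>A. mpoly_eval (R j a) (F x) * (\<Sum>i\<in>UNIV. c $ i * x $ i) ^ a) = 0) \<and>
     (\<exists>x. (\<Sum>a\<le>A. real a * mpoly_eval (C a) (F x) * (\<Sum>i\<in>UNIV. c $ i * x $ i) ^ (a - 1)) \<noteq> 0)"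
proof -
  let ?h = "\<lambda>(t::real^'n) x. \<Sum>i\<in>UNIV. t $ i * x $ i"
  let ?tm = "\<lambda>(t::real^'n) m. \<Prod>i\<in>UNIV. (t $ i) ^ m (Inl i :: 'n + 'n)"
  let ?Fm = "\<lambda>x m. \<Prod>i\<in>UNIV. (F x $ i) ^ m (Inr i :: 'n + 'n)"
  \<comment> \<open>The degree \<open>A\<close> in the linear form is kept apart from the bound
    \<open>T\<close> on the other exponents, so that it can be minimised by itself.\<close>
  define valid where "valid = (\<lambda>A. \<exists>T b. (\<exists>a\<le>A. \<exists>m\<in>exponent_box T. b a m \<noteq> 0) \<and>
     (\<forall>t x. (\<Sum>a\<le>A. \<Sum>m\<in>exponent_box T. b a m * ?h t x ^ a * (?tm t m * ?Fm x m)) = 0))"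
  have "\<exists>A. valid A"
    using algebraic_dependence unfolding valid_def by blast
  define A where "A = (LEAST A. valid A)"
  have "valid A" unfolding A_def using \<open>\<exists>A. valid A\<close> by (rule LeastI_ex)
  have least: "A \<le> A'" if "valid A'" for A'
    unfolding A_def using that by (rule Least_le)
  obtain T b where nz: "\<exists>a\<le>A. \<exists>m\<in>exponent_box T. b a m \<noteq> 0"
    and rel: "\<And>t x. (\<Sum>a\<le>A. \<Sum>m\<in>exponent_box T. b a m * ?h t x ^ a * (?tm t m * ?Fm x m)) = 0"
    using \<open>valid A\<close> unfolding valid_def by blast
  have "A \<noteq> 0"
  proof
    assume A: "A = 0"
    have "b 0 m = 0" if "m \<in> exponent_box T" for m
      by (rule no_relation_in_t_and_F[where b = "b 0" and T = T]) (use rel A that in simp_all)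
    with nz A show False by auto
  qed
  then obtain A' where A': "A = Suc A'" by (cases A) auto
  \<comment> \<open>If the derivative in the linear form vanished identically, either it would be a
    nontrivial relation of degree \<open>A'\<close>, or only the coefficients \<open>b 0\<close>
    would survive, giving degree 0. Both contradict the minimality of \<open>A\<close>, which is not
    0.\<close>
  have "\<exists>t x. (\<Sum>a\<le>A'. \<Sum>m\<in>exponent_box T. real (Suc a) * b (Suc a) m * ?h t x ^ a * (?tm t m * ?Fm x m)) \<noteq> 0"
  proof (rule ccontr)
    assume "\<not> ?thesis"
    then have z: "\<And>t x. (\<Sum>a\<le>A'. \<Sum>m\<in>exponent_box T. real (Suc a) * b (Suc a) m * ?h t x ^ a * (?tm t m * ?Fm x m)) = 0"
      by blast
    show False
    proof (cases "\<exists>a\<le>A'. \<exists>m\<in>exponent_box T. real (Suc a) * b (Suc a) m \<noteq> 0")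
      case True
      then have "valid A'" unfolding valid_def
        by (intro exI[of _ T] exI[of _ "\<lambda>a m. real (Suc a) * b (Suc a) m"] conjI allI z True)
      with least A' show False by force
    next
      case False
      then have b0: "b (Suc a) m = 0" if "a \<le> A'" "m \<in> exponent_box T" for a m
        using that by auto
      have "\<exists>m\<in>exponent_box T. b 0 m \<noteq> 0"
        using nz b0 A' by (metis Suc_le_mono not0_implies_Suc)
      moreover have "(\<Sum>m\<in>exponent_box T. b 0 m * ?h t x ^ 0 * (?tm t m * ?Fm x m)) = 0" for t x
        using rel[of t x] unfolding A' sum.atMost_Suc_shift by (simp add: b0)
      ultimately have "valid 0" unfolding valid_def
        by (intro exI[of _ T] exI[of _ b]) simp
      with least \<open>A \<noteq> 0\<close> show False by force
    qed
  qed
  then obtain c x0 where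
    ne: "(\<Sum>a\<le>A'. \<Sum>m\<in>exponent_box T. real (Suc a) * b (Suc a) m * ?h c x0 ^ a * (?tm c m * ?Fm x0 m)) \<noteq> 0"
    by blast
  \<comment> \<open>The derivatives of the \<open>t\<close>-monomials enter the result as numbers at
    the fixed point \<open>c\<close>, so existence and choice suffice. The term
    \<open>if i = j\<close> moves \<open>t\<close> along axis \<open>j\<close>.\<close>
  have "\<exists>D. ((\<lambda>s. \<Prod>i\<in>UNIV. (c $ i + s * (if i = j then 1 else 0)) ^ m (Inl i)) has_real_derivative D) (at 0)"
    for j and m :: "'n + 'n \<Rightarrow> nat"
  proof -
    have "(\<lambda>s::real. \<Prod>i\<in>S. (c $ i + s * (if i = j then 1 else 0)) ^ m (Inl i)) differentiable (at 0)"
      if "finite S" for S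
      using that
    proof (induction S)
      case (insert i S)
      have d: "(\<lambda>s::real. (c $ i + s * (if i = j then 1 else 0)) ^ m (Inl i)) differentiable (at 0)"
        by (intro derivative_intros)
      show ?case
        unfolding prod.insert[OF insert.hyps] by (rule differentiable_mult[OF d insert.IH])
    qed simp
    from this[of UNIV] show ?thesis by (auto simp: real_differentiable_def)
  qed
  then have "\<forall>j. \<forall>m :: 'n + 'n \<Rightarrow> nat. \<exists>D. ((\<lambda>s. \<Prod>i\<in>UNIV. (c $ i + s * (if i = j then 1 else 0)) ^ m (Inl i))
      has_real_derivative D) (at 0)"
    by blast
  then obtain D where "\<forall>j. \<forall>m :: 'n + 'n \<Rightarrow> nat. ((\<lambda>s. \<Prod>i\<in>UNIV. (c $ i + s * (if i = j then 1 else 0)) ^ m (Inl i))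
      has_real_derivative D j m) (at 0)"
    unfolding choice_iff by (elim exE)
  then have D: "((\<lambda>s. \<Prod>i\<in>UNIV. (c $ i + s * (if i = j then 1 else 0)) ^ m (Inl i))
      has_real_derivative D j m) (at 0)" for j and m :: "'n + 'n \<Rightarrow> nat"
    by (elim allE)
  \<comment> \<open>The part of \<open>m\<close> belonging to \<open>F\<close>, turned into a
    polynomial on the target space.\<close>
  define mono :: "('n + 'n \<Rightarrow> nat) \<Rightarrow> real \<Rightarrow> 'n real_mpoly"
    where "mono m r = Poly_Mapping.single (Abs_poly_mapping (\<lambda>i. m (Inr i))) r" for m r
  have mono: "mpoly_eval (mono m r) (F x) = r * ?Fm x m" for m r x
    by (simp add: mono_def mpoly_eval_single)
  define C where "C a = (\<Sum>m\<in>exponent_box T. mono m (b a m * ?tm c m))" for a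
  define R where "R j a = (\<Sum>m\<in>exponent_box T. mono m (b a m * D j m))" for j a
  have C: "mpoly_eval (C a) (F x) = (\<Sum>m\<in>exponent_box T. b a m * ?tm c m * ?Fm x m)" for a x
    by (simp add: C_def mpoly_eval_sum mono)
  have R: "mpoly_eval (R j a) (F x) = (\<Sum>m\<in>exponent_box T. b a m * D j m * ?Fm x m)" for j a x
    by (simp add: R_def mpoly_eval_sum mono)
  have 1: "(\<Sum>a\<le>A. mpoly_eval (C a) (F x) * ?h c x ^ a) = 0" for x
    using rel[of c x] by (simp add: C sum_distrib_left sum_distrib_right mult_ac)
  have 2: "(\<Sum>a\<le>A. real a * mpoly_eval (C a) (F x) * ?h c x ^ (a - 1)) * x $ j +
        (\<Sum>a\<le>A. mpoly_eval (R j a) (F x) * ?h c x ^ a) = 0" for x j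
  proof -
    \<comment> \<open>The relation vanishes along the line through \<open>c\<close> in direction
      \<open>j\<close>, so its derivative at \<open>s = 0\<close> is 0; the product rule splits this
      derivative into the two sums.\<close>
    let ?c = "\<lambda>s. c + s *\<^sub>R axis j 1"
    have hc: "?h (?c s) x = ?h c x + s * x $ j" for s
      by (simp add: algebra_simps sum.distrib axis_def if_distrib[of "\<lambda>y. _ * y"] sum_distrib_left[symmetric] cong: if_cong)
    have tc: "?tm (?c s) m = (\<Prod>i\<in>UNIV. (c $ i + s * (if i = j then 1 else 0)) ^ m (Inl i))" for s m
      by (intro prod.cong refl) (simp add: axis_def)
    let ?g = "\<lambda>s. \<Sum>a\<le>A. \<Sum>m\<in>exponent_box T. b a m * (?h c x + s * x $ j) ^ a *
        ((\<Prod>i\<in>UNIV. (c $ i + s * (if i = j then 1 else 0)) ^ m (Inl i)) * ?Fm x m)"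
    have g0: "?g s = 0" for s
      using rel[of "?c s" x] unfolding hc tc .
    have "(?g has_real_derivative (\<Sum>a\<le>A. \<Sum>m\<in>exponent_box T.
        (b a m * (real a * ?h c x ^ (a - 1) * x $ j)) * (?tm c m * ?Fm x m)
        + (b a m * ?h c x ^ a) * (D j m * ?Fm x m))) (at 0)"
      by (rule DERIV_sum, rule DERIV_sum) (auto intro!: derivative_eq_intros D)
    moreover have "(?g has_real_derivative 0) (at 0)"
      unfolding g0 by simp
    ultimately have "(\<Sum>a\<le>A. \<Sum>m\<in>exponent_box T.
        (b a m * (real a * ?h c x ^ (a - 1) * x $ j)) * (?tm c m * ?Fm x m)
        + (b a m * ?h c x ^ a) * (D j m * ?Fm x m)) = 0"
      by (rule DERIV_unique)
    then show ?thesis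
      by (simp add: C R sum.distrib sum_distrib_left sum_distrib_right mult_ac)
  qed
  \<comment> \<open>The summand at 0 carries the factor \<open>real 0\<close>, so the truncated
    exponent \<open>0 - 1\<close> does no harm and an index shift leads to
    \<open>ne\<close>.\<close>
  have 3: "(\<Sum>a\<le>A. real a * mpoly_eval (C a) (F x0) * ?h c x0 ^ (a - 1)) \<noteq> 0"
    using ne unfolding A' sum.atMost_Suc_shift by (simp add: C sum_distrib_left sum_distrib_right mult_ac)
  show ?thesis using 1 2 3 by blast
qed

end

section \<open>Values of rational functions\<close>

text \<open>
  A fraction may have a value at a zero of the denominator of one of its representations,
  so any representation is admitted.
\<close>

definition has_value :: "'n::{finite,linorder} ratfun \<Rightarrow> real ^ 'n::{finite,linorder} \<Rightarrow> real \<Rightarrow> bool" where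
  "has_value r x v \<longleftrightarrow> (\<exists>a b. r = Fract a b \<and> mpoly_eval b x \<noteq> 0 \<and> v = mpoly_eval a x / mpoly_eval b x)"

text \<open>Two representations of a fraction satisfy a cross-multiplied identity of polynomials,
  which can be evaluated at \<open>x\<close>.\<close>

lemma has_value_unique:
  assumes "has_value r x v" "has_value r x w"
  shows "v = w"
proof -
  obtain a b where ab: "r = Fract a b" "mpoly_eval b x \<noteq> 0" "v = mpoly_eval a x / mpoly_eval b x"
    using assms(1) unfolding has_value_def by blast
  obtain c d where cd: "r = Fract c d" "mpoly_eval d x \<noteq> 0" "w = mpoly_eval c x / mpoly_eval d x"
    using assms(2) unfolding has_value_def by blast
  have "a * d = c * b"
    using ab cd mpoly_eval_nonzero_imp eq_fract(1) by metis
  then have "mpoly_eval a x * mpoly_eval d x = mpoly_eval c x * mpoly_eval b x"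
    by (metis mpoly_eval_simps(4))
  then show ?thesis using ab cd by (simp add: frac_eq_eq)
qed

lemma has_value_poly: "has_value (Fract a 1) x (mpoly_eval a x)"
  unfolding has_value_def by (intro exI[of _ a] exI[of _ 1]) (simp add: mpoly_eval_simps)

lemma has_value_quotient: "mpoly_eval b x \<noteq> 0 \<Longrightarrow> has_value (Fract a b) x (mpoly_eval a x / mpoly_eval b x)"
  unfolding has_value_def by blast

lemma has_value_0: "has_value 0 x 0"
  using has_value_poly[of 0 x] by (simp add: Zero_fract_def mpoly_eval_simps)

lemma has_value_1: "has_value 1 x 1"
  using has_value_poly[of 1 x] by (simp add: One_fract_def mpoly_eval_simps)

lemma has_value_add:
  assumes "has_value r x v" "has_value s x w"
  shows "has_value (r + s) x (v + w)"
proof -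
  obtain a b where ab: "r = Fract a b" "mpoly_eval b x \<noteq> 0" "v = mpoly_eval a x / mpoly_eval b x"
    using assms(1) unfolding has_value_def by blast
  obtain c d where cd: "s = Fract c d" "mpoly_eval d x \<noteq> 0" "w = mpoly_eval c x / mpoly_eval d x"
    using assms(2) unfolding has_value_def by blast
  have "r + s = Fract (a * d + c * b) (b * d)"
    unfolding ab(1) cd(1) using ab cd by (intro add_fract) (auto dest: mpoly_eval_nonzero_imp)
  moreover have "v + w = mpoly_eval (a * d + c * b) x / mpoly_eval (b * d) x"
    using ab cd by (simp add: mpoly_eval_simps add_frac_eq)
  moreover have "mpoly_eval (b * d) x \<noteq> 0"
    using ab cd by (simp add: mpoly_eval_simps)
  ultimately show ?thesis unfolding has_value_def by blast
qed

lemma has_value_mult: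
  assumes "has_value r x v" "has_value s x w"
  shows "has_value (r * s) x (v * w)"
proof -
  obtain a b where ab: "r = Fract a b" "mpoly_eval b x \<noteq> 0" "v = mpoly_eval a x / mpoly_eval b x"
    using assms(1) unfolding has_value_def by blast
  obtain c d where cd: "s = Fract c d" "mpoly_eval d x \<noteq> 0" "w = mpoly_eval c x / mpoly_eval d x"
    using assms(2) unfolding has_value_def by blast
  have "r * s = Fract (a * c) (b * d)"
    by (simp add: ab(1) cd(1))
  moreover have "v * w = mpoly_eval (a * c) x / mpoly_eval (b * d) x"
    using ab cd by (simp add: mpoly_eval_simps)
  moreover have "mpoly_eval (b * d) x \<noteq> 0"
    using ab cd by (simp add: mpoly_eval_simps)
  ultimately show ?thesis unfolding has_value_def by blast
qed

lemma has_value_const: "has_value (Fract (Poly_Mapping.single 0 c) 1) x c"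
  using has_value_poly[of "Poly_Mapping.single 0 c" x] by (simp add: mpoly_eval_simps)

lemma has_value_uminus: "has_value r x v \<Longrightarrow> has_value (- r) x (- v)"
proof -
  have "has_value (- 1) x (- 1)"
    using has_value_poly[of "- 1" x] by (simp add: One_fract_def mpoly_eval_simps)
  then show "has_value r x v \<Longrightarrow> has_value (- r) x (- v)"
    using has_value_mult[of "- 1" x "- 1" r v] by simp
qed

lemma has_value_diff: "has_value r x v \<Longrightarrow> has_value s x w \<Longrightarrow> has_value (r - s) x (v - w)"
  using has_value_add[OF _ has_value_uminus] by fastforce

lemma has_value_inverse:
  assumes "has_value r x v" "v \<noteq> 0"
  shows "has_value (inverse r) x (inverse v)"
proof -
  obtain a b where ab: "r = Fract a b" "mpoly_eval b x \<noteq> 0" "v = mpoly_eval a x / mpoly_eval b x"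
    using assms(1) unfolding has_value_def by blast
  then show ?thesis unfolding has_value_def using assms(2)
    by (intro exI[of _ b] exI[of _ a]) auto
qed

lemma has_value_divide:
  "has_value r x v \<Longrightarrow> has_value s x w \<Longrightarrow> w \<noteq> 0 \<Longrightarrow> has_value (r / s) x (v / w)"
  unfolding divide_inverse by (intro has_value_mult has_value_inverse)

lemma has_value_sum:
  "(\<And>s. s \<in> S \<Longrightarrow> has_value (f s) x (g s)) \<Longrightarrow> has_value (\<Sum>s\<in>S. f s) x (\<Sum>s\<in>S. g s)"
  by (induction S rule: infinite_finite_induct) (auto intro: has_value_0 has_value_add)

lemma has_value_prod:
  "(\<And>s. s \<in> S \<Longrightarrow> has_value (f s) x (g s)) \<Longrightarrow> has_value (\<Prod>s\<in>S. f s) x (\<Prod>s\<in>S. g s)"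
  by (induction S rule: infinite_finite_induct) (auto intro: has_value_1 has_value_mult)

lemma has_value_power: "has_value r x v \<Longrightarrow> has_value (r ^ k) x (v ^ k)"
  by (induction k) (auto intro: has_value_1 has_value_mult)

section \<open>Generic points and specialisation of coefficients\<close>

text \<open>The filter generated by the complements of proper algebraic hypersurfaces. As a filter
  it lets finitely many genericity conditions be combined by \<open>eventually_elim\<close>.\<close>

definition generic :: "(real ^ 'n::{finite,linorder}) filter" where
  "generic = (INF b\<in>{b :: 'n::{finite,linorder} real_mpoly. b \<noteq> 0}. principal {y. mpoly_eval b y \<noteq> 0})"

lemma eventually_generic:
  "eventually P generic \<longleftrightarrow> (\<exists>b. b \<noteq> 0 \<and> (\<forall>y. mpoly_eval b y \<noteq> 0 \<longrightarrow> P y))"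
proof -
  have "eventually P generic \<longleftrightarrow>
      (\<exists>b\<in>{b :: 'a real_mpoly. b \<noteq> 0}. eventually P (principal {y. mpoly_eval b y \<noteq> 0}))"
    unfolding generic_def
  proof (rule eventually_INF_base)
    show "{b :: 'a real_mpoly. b \<noteq> 0} \<noteq> {}" using one_neq_zero by blast
    fix a b :: "'a real_mpoly"
    assume "a \<in> {b. b \<noteq> 0}" "b \<in> {b. b \<noteq> 0}"
    then show "\<exists>x\<in>{b. b \<noteq> 0}. principal {y. mpoly_eval x y \<noteq> 0} \<le>
        inf (principal {y. mpoly_eval a y \<noteq> 0}) (principal {y. mpoly_eval b y \<noteq> 0})"
      by (intro bexI[of _ "a * b"]) (auto simp: mpoly_eval_simps)
  qed
  then show ?thesis by (auto simp: eventually_principal)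
qed

text \<open>Complements of proper algebraic subsets are dense. Through this, results on generic
  points reach the neighbourhood of any point.\<close>

lemma eventually_generic_in_open:
  assumes "eventually P generic" "open U" "U \<noteq> {}"
  obtains y where "y \<in> U" "P y"
  using assms mpoly_eval_nonzero_on_open unfolding eventually_generic by metis

lemma eventually_has_value: "eventually (\<lambda>y. \<exists>v. has_value r y v) generic"
proof (cases r)
  case (Fract a b)
  then show ?thesis
    unfolding eventually_generic by (intro exI[of _ b]) (auto intro: has_value_quotient)
qed

lemma has_value_0_imp:
  assumes "\<And>x. has_value r x 0"
  shows "r = 0"
proof (cases r)
  case (Fract a b)
  have "a * b = 0"
  proof (rule ccontr)
    assume "a * b \<noteq> 0"
    then obtain x where x: "mpoly_eval (a * b) x \<noteq> 0"
      using mpoly_eval_nonzero_on_open[of "a * b" UNIV] by blast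
    then have "has_value r x (mpoly_eval a x / mpoly_eval b x)"
      using Fract by (auto intro: has_value_quotient simp: mpoly_eval_simps)
    then have "mpoly_eval a x / mpoly_eval b x = 0" using assms has_value_unique by blast
    with x show False by (simp add: mpoly_eval_simps)
  qed
  with Fract show ?thesis by (simp add: fract_collapse)
qed

lemma eventually_has_value_nonzero:
  assumes "r \<noteq> 0"
  shows "eventually (\<lambda>y. \<exists>v. has_value r y v \<and> v \<noteq> 0) generic"
proof (cases r)
  case (Fract a b)
  with assms have "a \<noteq> 0" by (auto simp: fract_collapse)
  with Fract show ?thesis
    unfolding eventually_generic
    by (intro exI[of _ "a * b"]) (auto intro!: exI has_value_quotient simp: mpoly_eval_simps)
qed

text \<open>Specialisation of a polynomial at \<open>y\<close>. The degree drops where the leading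
  coefficient takes the value 0.\<close>

definition has_poly_value :: "'n::{finite,linorder} ratfun poly \<Rightarrow> real ^ 'n::{finite,linorder} \<Rightarrow> real poly \<Rightarrow> bool" where
  "has_poly_value s y S \<longleftrightarrow> (\<forall>k. has_value (Polynomial.coeff s k) y (Polynomial.coeff S k))"

lemma has_poly_value_unique: "has_poly_value s y S \<Longrightarrow> has_poly_value s y T \<Longrightarrow> S = T"
  unfolding has_poly_value_def by (intro poly_eqI) (blast intro: has_value_unique)

lemma has_poly_value_0: "has_poly_value 0 y 0"
  by (simp add: has_poly_value_def has_value_0)

lemma has_poly_value_add:
  "has_poly_value s y S \<Longrightarrow> has_poly_value t y T \<Longrightarrow> has_poly_value (s + t) y (S + T)"
  by (simp add: has_poly_value_def has_value_add)

lemma has_poly_value_diff: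
  "has_poly_value s y S \<Longrightarrow> has_poly_value t y T \<Longrightarrow> has_poly_value (s - t) y (S - T)"
  by (simp add: has_poly_value_def has_value_diff)

lemma has_poly_value_mult:
  "has_poly_value s y S \<Longrightarrow> has_poly_value t y T \<Longrightarrow> has_poly_value (s * t) y (S * T)"
  by (auto simp: has_poly_value_def Polynomial.coeff_mult intro!: has_value_sum has_value_mult)

lemma has_poly_value_monom: "has_value r y v \<Longrightarrow> has_poly_value (Polynomial.monom r k) y (Polynomial.monom v k)"
  by (auto simp: has_poly_value_def has_value_0)

lemma has_poly_value_const: "has_value r y v \<Longrightarrow> has_poly_value [:r:] y [:v:]"
  using has_poly_value_monom[of r y v 0] by (simp add: monom_0)

lemma has_poly_value_1: "has_poly_value 1 y 1"
  using has_poly_value_const[OF has_value_1] by (simp add: one_pCons)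

lemma has_poly_value_sum:
  "(\<And>s. s \<in> S \<Longrightarrow> has_poly_value (f s) y (g s)) \<Longrightarrow> has_poly_value (\<Sum>s\<in>S. f s) y (\<Sum>s\<in>S. g s)"
  by (induction S rule: infinite_finite_induct) (auto intro: has_poly_value_0 has_poly_value_add)

lemma has_poly_value_prod:
  "(\<And>s. s \<in> S \<Longrightarrow> has_poly_value (f s) y (g s)) \<Longrightarrow> has_poly_value (\<Prod>s\<in>S. f s) y (\<Prod>s\<in>S. g s)"
  by (induction S rule: infinite_finite_induct) (auto intro: has_poly_value_1 has_poly_value_mult)

lemma has_poly_value_power: "has_poly_value s y S \<Longrightarrow> has_poly_value (s ^ k) y (S ^ k)"
  by (induction k) (auto intro: has_poly_value_1 has_poly_value_mult)

lemma has_value_of_nat: "has_value (of_nat k) y (of_nat k)"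
  by (induction k) (auto intro: has_value_0 has_value_1 has_value_add)

lemma has_poly_value_pderiv: "has_poly_value s y S \<Longrightarrow> has_poly_value (pderiv s) y (pderiv S)"
  unfolding has_poly_value_def Polynomial.coeff_pderiv
  by (intro allI has_value_mult has_value_of_nat) blast

lemma eventually_has_poly_value: "eventually (\<lambda>y. \<exists>S. has_poly_value s y S) generic"
proof -
  have "eventually (\<lambda>y. \<forall>k\<in>{..Polynomial.degree s}. \<exists>v. has_value (Polynomial.coeff s k) y v) generic"
    by (intro eventually_ball_finite ballI eventually_has_value) simp
  then show ?thesis
  proof eventually_elim
    case (elim y)
    then obtain v where v: "\<And>k. k \<le> Polynomial.degree s \<Longrightarrow> has_value (Polynomial.coeff s k) y (v k)"
      by (metis atMost_iff)
    have "has_poly_value (\<Sum>k\<le>Polynomial.degree s. Polynomial.monom (Polynomial.coeff s k) k) y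
        (\<Sum>k\<le>Polynomial.degree s. Polynomial.monom (v k) k)"
      by (intro has_poly_value_sum has_poly_value_monom v) simp
    then show ?case by (auto simp: poly_as_sum_of_monoms)
  qed
qed

section \<open>Constants and coordinates as rational functions\<close>

definition ratfun_const :: "real \<Rightarrow> 'n::{finite,linorder} ratfun" where
  "ratfun_const c = Fract (Poly_Mapping.single 0 c) 1"

interpretation ratfun_const: scalar_hom ratfun_const
proof
  show "ratfun_const (a + b) = ratfun_const a + ratfun_const b" for a b
    by (simp add: ratfun_const_def single_add)
  show "ratfun_const (a * b) = ratfun_const a * ratfun_const b" for a b
    by (simp add: ratfun_const_def mult_single)
  show "ratfun_const 1 = 1"
    by (simp add: ratfun_const_def One_fract_def)
qed

lemma has_value_ratfun_const: "has_value (ratfun_const c) x c"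
  by (simp add: ratfun_const_def has_value_const)

interpretation poly_const: scalar_hom "\<lambda>c :: real. [:c:]"
  by unfold_locales (auto simp: one_pCons)

interpretation ratfun_poly_const: scalar_hom "\<lambda>c. [:ratfun_const c:]"
  by unfold_locales (auto simp: one_pCons ratfun_const.add ratfun_const.mult)

definition ratfun_var :: "'n::{finite,linorder} \<Rightarrow> 'n::{finite,linorder} ratfun" where
  "ratfun_var i = Fract (Poly_Mapping.single (Poly_Mapping.single i 1) 1) 1"

lemma has_value_ratfun_var: "has_value (ratfun_var i) x (x $ i)"
proof -
  have "(\<Prod>j\<in>UNIV. (x $ j) ^ Poly_Mapping.lookup (Poly_Mapping.single i (1::nat)) j)
      = (\<Prod>j\<in>UNIV. if j = i then x $ j else 1)"
    by (intro prod.cong refl) (simp add: lookup_single)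
  then show ?thesis
    using has_value_poly[of "Poly_Mapping.single (Poly_Mapping.single i 1) 1" x]
    by (simp add: ratfun_var_def mpoly_eval_single)
qed

lemma has_value_subst:
  assumes "\<And>i. has_value (g i) x (v i)"
  shows "has_value (mpoly_subst ratfun_const g p) x (mpoly_subst id v p)"
  unfolding mpoly_subst_def
  by (intro has_value_sum has_value_mult has_value_prod has_value_power assms) (simp add: has_value_ratfun_const)

lemma has_poly_value_subst:
  assumes "\<And>i. has_poly_value (g i) y (G i)"
  shows "has_poly_value (mpoly_subst (\<lambda>c. [:ratfun_const c:]) g p) y (mpoly_subst (\<lambda>c. [:c:]) G p)"
  unfolding mpoly_subst_def
  by (intro has_poly_value_sum has_poly_value_mult has_poly_value_prod has_poly_value_power assms
      has_poly_value_const has_value_ratfun_const)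

text \<open>The difference has the value 0 everywhere. This lets identities in the function field be
  checked pointwise.\<close>

lemma has_value_eqI:
  assumes "\<And>x. has_value r x (g x)" "\<And>x. has_value s x (g x)"
  shows "r = s"
proof -
  have "has_value (r - s) x 0" for x
    using has_value_diff[OF assms(1)[of x] assms(2)[of x]] by simp
  then show ?thesis using has_value_0_imp by fastforce
qed

lemma subst_ratfun_var: "mpoly_subst ratfun_const ratfun_var p = Fract p 1"
  by (rule has_value_eqI[OF has_value_subst[OF has_value_ratfun_var]])
    (use has_value_poly in \<open>simp add: mpoly_eval_eq_subst\<close>)

section \<open>The minimal polynomial of the linear form\<close>

lemma poly_eq_sum_upto:
  fixes p :: "'a::comm_ring_1 poly"
  assumes "Polynomial.degree p \<le> N"
  shows "poly p x = (\<Sum>k\<le>N. Polynomial.coeff p k * x ^ k)"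
proof -
  have "poly p x = poly (\<Sum>k\<le>N. Polynomial.monom (Polynomial.coeff p k) k) x"
    using assms by (simp add: poly_as_sum_of_monoms')
  then show ?thesis by (simp add: poly_sum Polynomial.poly_monom)
qed

text \<open>Fixes the data supplied by \<open>primitive_linear_form\<close>.\<close>

locale primitive_rational_map = open_rational_map F P Q
  for F :: "real ^ 'n::{finite,linorder} \<Rightarrow> real ^ 'n::{finite,linorder}" and P Q +
  fixes c :: "real ^ 'n::{finite,linorder}" and A :: nat and C :: "nat \<Rightarrow> 'n real_mpoly"
    and R :: "'n \<Rightarrow> nat \<Rightarrow> 'n real_mpoly"
  assumes relation: "(\<Sum>a\<le>A. mpoly_eval (C a) (F x) * (\<Sum>i\<in>UNIV. c $ i * x $ i) ^ a) = 0"
    and coordinate_relation: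
      "(\<Sum>a\<le>A. real a * mpoly_eval (C a) (F x) * (\<Sum>i\<in>UNIV. c $ i * x $ i) ^ (a - 1)) * x $ j +
        (\<Sum>a\<le>A. mpoly_eval (R j a) (F x) * (\<Sum>i\<in>UNIV. c $ i * x $ i) ^ a) = 0"
    and separable:
      "\<exists>x. (\<Sum>a\<le>A. real a * mpoly_eval (C a) (F x) * (\<Sum>i\<in>UNIV. c $ i * x $ i) ^ (a - 1)) \<noteq> 0"
begin

section \<open>The function field of the target inside that of the domain\<close>

definition component :: "'n \<Rightarrow> 'n ratfun" where
  "component i = Fract (P i) (Q i)"

lemma has_value_component: "has_value (component i) x (F x $ i)"
  unfolding component_def F_eq by (rule has_value_quotient[OF Q_nonzero])

text \<open>Composition with \<open>F\<close>, as an element of the function field of the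
  domain.\<close>

definition pullback_poly :: "'n real_mpoly \<Rightarrow> 'n ratfun" where
  "pullback_poly a = mpoly_subst ratfun_const component a"

lemma has_value_pullback_poly: "has_value (pullback_poly a) x (mpoly_eval a (F x))"
  unfolding pullback_poly_def mpoly_eval_eq_subst by (rule has_value_subst[OF has_value_component])

text \<open>The range of \<open>F\<close> has nonempty interior, and a nonzero polynomial is nonzero
  somewhere in it. Hence denominators stay nonzero under composition with \<open>F\<close>.\<close>

lemma pullback_poly_eq_0_iff: "pullback_poly a = 0 \<longleftrightarrow> a = 0"
proof
  assume z: "pullback_poly a = 0"
  show "a = 0"
  proof (rule ccontr)
    assume "a \<noteq> 0"
    moreover have "interior (range F) \<noteq> {}" using interior_image[of UNIV 0] by auto
    ultimately obtain y where y: "y \<in> interior (range F)" "mpoly_eval a y \<noteq> 0"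
      using mpoly_eval_nonzero_on_open[of a "interior (range F)"] by auto
    then obtain x where "y = F x" using interior_subset by blast
    with y z has_value_pullback_poly[of a x] has_value_unique[OF _ has_value_0] show False by auto
  qed
qed (simp add: pullback_poly_def)

text \<open>The embedding of the rational function field of the target onto \<open>\<real>(F)\<close>.\<close>

definition pullback :: "'n ratfun \<Rightarrow> 'n ratfun" where
  "pullback r = (SOME z. \<exists>a b. b \<noteq> 0 \<and> r = Fract a b \<and> z = pullback_poly a / pullback_poly b)"

text \<open>Cross-multiplication is preserved by \<open>pullback_poly\<close>, so the representation
  picked by \<open>SOME\<close> is immaterial.\<close>

lemma pullback_Fract:
  assumes "b \<noteq> 0"
  shows "pullback (Fract a b) = pullback_poly a / pullback_poly b"
proof -
  have "\<exists>z a' b'. b' \<noteq> 0 \<and> Fract a b = Fract a' b' \<and> z = pullback_poly a' / pullback_poly b'"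
    using assms by blast
  from someI_ex[OF this] obtain a' b' where ab: "b' \<noteq> 0" "Fract a b = Fract a' b'"
    "pullback (Fract a b) = pullback_poly a' / pullback_poly b'"
    unfolding pullback_def by blast
  then have "a * b' = a' * b" using assms eq_fract(1) by blast
  then have "pullback_poly a * pullback_poly b' = pullback_poly a' * pullback_poly b"
    by (metis pullback_poly_def ratfun_const.subst_mult)
  with ab assms show ?thesis by (simp add: frac_eq_eq pullback_poly_eq_0_iff)
qed

lemma has_value_pullback:
  assumes "has_value r (F x) v"
  shows "has_value (pullback r) x v"
proof -
  obtain a b where ab: "r = Fract a b" "mpoly_eval b (F x) \<noteq> 0" "v = mpoly_eval a (F x) / mpoly_eval b (F x)"
    using assms unfolding has_value_def by blast
  then have "pullback r = pullback_poly a / pullback_poly b"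
    using pullback_Fract mpoly_eval_nonzero_imp by blast
  with ab show ?thesis
    by (auto intro!: has_value_divide has_value_pullback_poly)
qed

lemma pullback_add: "pullback (r + s) = pullback r + pullback s"
proof (cases r, cases s)
  fix a b a' b' assume rs: "r = Fract a b" "b \<noteq> 0" "s = Fract a' b'" "b' \<noteq> 0"
  then have "pullback (r + s) = pullback_poly (a * b' + a' * b) / pullback_poly (b * b')"
    by (simp add: pullback_Fract)
  also have "\<dots> = pullback_poly a / pullback_poly b + pullback_poly a' / pullback_poly b'"
    using rs pullback_poly_eq_0_iff[of b] pullback_poly_eq_0_iff[of b']
    by (simp add: add_frac_eq pullback_poly_def ratfun_const.subst_add ratfun_const.subst_mult)
  finally show ?thesis using rs by (simp add: pullback_Fract)
qed

lemma pullback_mult: "pullback (r * s) = pullback r * pullback s"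
proof (cases r, cases s)
  fix a b a' b' assume rs: "r = Fract a b" "b \<noteq> 0" "s = Fract a' b'" "b' \<noteq> 0"
  then have "pullback (r * s) = pullback_poly (a * a') / pullback_poly (b * b')"
    by (simp add: pullback_Fract)
  also have "\<dots> = (pullback_poly a / pullback_poly b) * (pullback_poly a' / pullback_poly b')"
    by (simp add: pullback_poly_def ratfun_const.subst_mult)
  finally show ?thesis using rs by (simp add: pullback_Fract)
qed

lemma pullback_poly_1 [simp]: "pullback_poly 1 = 1"
  by (simp add: pullback_poly_def)

lemma pullback_poly_0 [simp]: "pullback_poly 0 = 0"
  by (simp add: pullback_poly_def)

lemma pullback_0 [simp]: "pullback 0 = 0"
  by (simp add: Zero_fract_def pullback_Fract)

lemma pullback_1 [simp]: "pullback 1 = 1"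
  by (simp add: One_fract_def pullback_Fract)

lemma pullback_uminus: "pullback (- r) = - pullback r"
  using pullback_add[of r "- r"] by (simp add: eq_neg_iff_add_eq_0 add.commute)

lemma pullback_sum: "pullback (\<Sum>s\<in>S. g s) = (\<Sum>s\<in>S. pullback (g s))"
  by (induction S rule: infinite_finite_induct) (auto simp: pullback_add)

lemma pullback_eq_0_iff: "pullback r = 0 \<longleftrightarrow> r = 0"
proof (cases r)
  case (Fract a b)
  have "r = 0 \<longleftrightarrow> a = 0"
    unfolding Zero_fract_def Fract(1) using Fract(2) by (subst eq_fract(1)) auto
  moreover have "pullback r = 0 \<longleftrightarrow> a = 0"
    using Fract(2) by (simp add: Fract(1) pullback_Fract pullback_poly_eq_0_iff)
  ultimately show ?thesis by simp
qed

lemma pullback_const: "pullback (ratfun_const a) = ratfun_const a"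
  unfolding ratfun_const_def[of a]
  by (simp add: pullback_Fract) (simp add: pullback_poly_def ratfun_const_def)

lemma pullback_var: "pullback (ratfun_var i) = component i"
  by (rule has_value_eqI[OF has_value_pullback[OF has_value_ratfun_var] has_value_component])

lemma inverse_pullback: "inverse (pullback r) = pullback (inverse r)"
proof (cases "r = 0")
  case False
  then have "pullback r * pullback (inverse r) = 1" by (simp flip: pullback_mult)
  then show ?thesis by (rule inverse_unique)
qed simp

section \<open>Evaluation of polynomials at the linear form\<close>

abbreviation form :: "real ^ 'n::{finite,linorder} \<Rightarrow> real" where
  "form x \<equiv> \<Sum>i\<in>UNIV. c $ i * x $ i"

definition form_ratfun :: "'n ratfun" where
  "form_ratfun = (\<Sum>i\<in>UNIV. ratfun_const (c $ i) * ratfun_var i)"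

lemma has_value_form: "has_value form_ratfun x (form x)"
  unfolding form_ratfun_def
  by (intro has_value_sum has_value_mult has_value_ratfun_const has_value_ratfun_var)

text \<open>The evaluation homomorphism at the linear form. Its coefficients are taken from the
  function field of the target and embedded by \<open>pullback\<close>.\<close>

definition eval_form :: "'n ratfun poly \<Rightarrow> 'n ratfun" where
  "eval_form s = poly (map_poly pullback s) form_ratfun"

lemma eval_form_add: "eval_form (s + t) = eval_form s + eval_form t"
proof -
  have "map_poly pullback (s + t) = map_poly pullback s + map_poly pullback t"
    by (intro poly_eqI) (simp add: coeff_map_poly pullback_add)
  then show ?thesis by (simp add: eval_form_def)
qed

lemma eval_form_mult: "eval_form (s * t) = eval_form s * eval_form t"
proof -
  have "map_poly pullback (s * t) = map_poly pullback s * map_poly pullback t"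
    by (intro poly_eqI) (simp add: coeff_map_poly Polynomial.coeff_mult pullback_sum pullback_mult)
  then show ?thesis by (simp add: eval_form_def)
qed

lemma eval_form_const: "eval_form [:r:] = pullback r"
  by (cases "r = 0") (simp_all add: eval_form_def map_poly_pCons)

lemma eval_form_0 [simp]: "eval_form 0 = 0"
  by (simp add: eval_form_def)

lemma eval_form_1 [simp]: "eval_form 1 = 1"
  using eval_form_const[of 1] by (simp add: one_pCons)

lemma eval_form_X: "eval_form [:0, 1:] = form_ratfun"
  by (simp add: eval_form_def map_poly_pCons)

lemma eval_form_uminus: "eval_form (- s) = - eval_form s"
  using eval_form_add[of s "- s"] by (simp add: eq_neg_iff_add_eq_0 add.commute)

lemma eval_form_diff: "eval_form (s - t) = eval_form s - eval_form t"
  using eval_form_add[of s "- t"] by (simp add: eval_form_uminus)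

lemma eval_form_sum: "eval_form (\<Sum>s\<in>S. g s) = (\<Sum>s\<in>S. eval_form (g s))"
  by (induction S rule: infinite_finite_induct) (auto simp: eval_form_add)

lemma eval_form_prod: "eval_form (\<Prod>s\<in>S. g s) = (\<Prod>s\<in>S. eval_form (g s))"
  by (induction S rule: infinite_finite_induct) (auto simp: eval_form_mult)

lemma eval_form_power: "eval_form (s ^ k) = eval_form s ^ k"
  by (induction k) (auto simp: eval_form_mult)

lemma eval_form_subst:
  "eval_form (mpoly_subst (\<lambda>a. [:ratfun_const a:]) g p) = mpoly_subst ratfun_const (\<lambda>i. eval_form (g i)) p"
  by (simp only: mpoly_subst_def eval_form_sum eval_form_mult eval_form_prod eval_form_power
      eval_form_const pullback_const)

lemma eval_form_eq_sum:
  assumes "Polynomial.degree s \<le> N"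
  shows "eval_form s = (\<Sum>k\<le>N. pullback (Polynomial.coeff s k) * form_ratfun ^ k)"
proof -
  have "Polynomial.degree (map_poly pullback s) \<le> N"
    by (rule degree_le) (use assms in \<open>simp add: coeff_map_poly Polynomial.coeff_eq_0\<close>)
  from poly_eq_sum_upto[OF this] show ?thesis
    by (simp add: eval_form_def coeff_map_poly)
qed

text \<open>A coefficient specialised at \<open>F x\<close> has the same value as its pullback at
  \<open>x\<close>. This is the bridge from identities in the field to points of fibers.\<close>

lemma has_value_eval_form:
  assumes "has_poly_value s (F x) S"
  shows "has_value (eval_form s) x (poly S (form x))"
proof -
  let ?N = "max (Polynomial.degree s) (Polynomial.degree S)"
  have "has_value (\<Sum>k\<le>?N. pullback (Polynomial.coeff s k) * form_ratfun ^ k) x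
      (\<Sum>k\<le>?N. Polynomial.coeff S k * form x ^ k)"
    using assms unfolding has_poly_value_def
    by (intro has_value_sum has_value_mult has_value_power has_value_form has_value_pullback) auto
  then show ?thesis
    by (simp add: eval_form_eq_sum[of s ?N] poly_eq_sum_upto[of S ?N])
qed

text \<open>The weights \<open>w\<close> and exponents \<open>e\<close> cover both the relation
  itself and its derivative in the linear form.\<close>

lemma has_poly_value_sum_monom:
  "has_poly_value (\<Sum>a\<le>N. Polynomial.monom (of_nat (w a) * Fract (B a) 1) (e a)) y
    (\<Sum>a\<le>N. Polynomial.monom (of_nat (w a) * mpoly_eval (B a) y) (e a))"
  by (intro has_poly_value_sum has_poly_value_monom has_value_mult has_value_of_nat has_value_poly)

lemma has_value_eval_form_sum:
  "has_value (eval_form (\<Sum>a\<le>N. Polynomial.monom (of_nat (w a) * Fract (B a) 1) (e a))) x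
    (\<Sum>a\<le>N. of_nat (w a) * mpoly_eval (B a) (F x) * form x ^ e a)"
  using has_value_eval_form[OF has_poly_value_sum_monom[of w B e N "F x"]]
  by (simp add: poly_sum Polynomial.poly_monom)

text \<open>The \<open>C a\<close> are the coefficients of such a polynomial; were all of them 0,
  the derivative in \<open>separable\<close> would vanish identically.\<close>

lemma eval_form_kernel_nontrivial: "\<exists>s. s \<noteq> 0 \<and> eval_form s = 0"
proof -
  define s where "s = (\<Sum>a\<le>A. Polynomial.monom (of_nat 1 * Fract (C a) 1) a)"
  have "has_value (eval_form s) x 0" for x
    using has_value_eval_form_sum[of "\<lambda>_. 1" C "\<lambda>a. a" A x] relation[of x] by (simp add: s_def)
  then have "eval_form s = 0" by (rule has_value_0_imp)
  moreover have "s \<noteq> 0"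
  proof
    assume "s = 0"
    have "C a = 0" if "a \<le> A" for a
    proof -
      have "0 = Polynomial.coeff s a" using \<open>s = 0\<close> by simp
      also have "\<dots> = (\<Sum>b\<le>A. if b = a then Fract (C a) 1 else 0)"
        unfolding s_def Polynomial.coeff_sum by (intro sum.cong) auto
      also have "\<dots> = Fract (C a) 1" using that by simp
      finally show ?thesis by (simp add: Zero_fract_def eq_fract)
    qed
    then show False using separable by (simp add: mpoly_eval_simps)
  qed
  ultimately show ?thesis by blast
qed

section \<open>The minimal polynomial and inverses\<close>

text \<open>The minimal polynomial of the linear form over R(F), up to a scalar: it is not
  normalised to be monic.\<close>

definition min_poly :: "'n ratfun poly" where
  "min_poly = (ARG_MIN Polynomial.degree s. s \<noteq> 0 \<and> eval_form s = 0)"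

lemma min_poly: "min_poly \<noteq> 0" "eval_form min_poly = 0"
    "s \<noteq> 0 \<Longrightarrow> eval_form s = 0 \<Longrightarrow> Polynomial.degree min_poly \<le> Polynomial.degree s"
proof -
  obtain s0 where "s0 \<noteq> 0 \<and> eval_form s0 = 0" using eval_form_kernel_nontrivial by blast
  from arg_min_nat_lemma[of "\<lambda>s. s \<noteq> 0 \<and> eval_form s = 0", OF this, of Polynomial.degree]
  show "min_poly \<noteq> 0" "eval_form min_poly = 0"
    "s \<noteq> 0 \<Longrightarrow> eval_form s = 0 \<Longrightarrow> Polynomial.degree min_poly \<le> Polynomial.degree s"
    unfolding min_poly_def by blast+
qed

lemma eval_form_mod_min_poly: "eval_form (s mod min_poly) = eval_form s"
proof -
  have "eval_form s = eval_form (s div min_poly * min_poly + s mod min_poly)" by simp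
  then show ?thesis by (simp only: eval_form_add eval_form_mult min_poly(2)) simp
qed

text \<open>Reduction modulo \<open>min_poly\<close> does not change the image, and a nonzero
  remainder in the kernel would contradict minimality of the degree.\<close>

lemma eval_form_eq_0_iff: "eval_form s = 0 \<longleftrightarrow> min_poly dvd s"
proof
  assume "eval_form s = 0"
  then have "eval_form (s mod min_poly) = 0" by (simp add: eval_form_mod_min_poly)
  then have "s mod min_poly = 0"
    using min_poly(3)[of "s mod min_poly"] degree_mod_less[OF min_poly(1), of s] by linarith
  then show "min_poly dvd s" by (simp add: dvd_eq_mod_eq_0)
next
  assume "min_poly dvd s"
  then show "eval_form s = 0" by (auto simp: dvd_def eval_form_mult min_poly)
qed

text \<open>Bezout: an element \<open>g\<close> of least degree in the ideal of \<open>s\<close> and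
  \<open>min_poly\<close> divides both and turns out to be constant; its representation
  \<open>a * s + b * min_poly\<close> yields the inverse.\<close>

lemma eval_form_invertible:
  assumes "eval_form s \<noteq> 0"
  shows "\<exists>t. eval_form t * eval_form s = 1"
proof -
  define I where "I = {g. \<exists>a b. g = a * s + b * min_poly}"
  have "min_poly \<in> I" unfolding I_def by (auto intro: exI[of _ 0] exI[of _ 1])
  then have "min_poly \<in> I \<and> min_poly \<noteq> 0" using min_poly(1) by blast
  then obtain g where g: "g \<in> I" "g \<noteq> 0"
    and least: "\<And>k. k \<in> I \<Longrightarrow> k \<noteq> 0 \<Longrightarrow> Polynomial.degree g \<le> Polynomial.degree k"
    using ex_has_least_nat[of "\<lambda>g. g \<in> I \<and> g \<noteq> 0" min_poly Polynomial.degree] by blast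
  obtain a b where ab: "g = a * s + b * min_poly" using g by (auto simp: I_def)
  have dvd: "g dvd k" if "k \<in> I" for k
  proof -
    obtain a' b' where k: "k = a' * s + b' * min_poly" using \<open>k \<in> I\<close> by (auto simp: I_def)
    have "k mod g = k - k div g * g" by (simp add: minus_div_mult_eq_mod)
    also have "\<dots> = (a' - k div g * a) * s + (b' - k div g * b) * min_poly"
      by (subst (2) ab, subst (1) k) (simp add: algebra_simps)
    finally have "k mod g \<in> I" by (auto simp: I_def)
    then have "k mod g = 0"
      using least[of "k mod g"] degree_mod_less[OF g(2), of k] by linarith
    then show ?thesis by (simp add: dvd_eq_mod_eq_0)
  qed
  have "s \<in> I" unfolding I_def by (auto intro: exI[of _ 0] exI[of _ 1])
  then have "g dvd s" by (rule dvd)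
  then have "eval_form g \<noteq> 0" using assms eval_form_eq_0_iff dvd_trans by blast
  \<comment> \<open>As \<open>g\<close> does not evaluate to 0, the cofactor \<open>k\<close> does;
    minimality of \<open>min_poly\<close> then leaves degree 0 for \<open>g\<close>.\<close>
  obtain k where k: "min_poly = g * k" using dvd[OF \<open>min_poly \<in> I\<close>] by (auto simp: dvd_def)
  then have "eval_form g * eval_form k = 0" using min_poly(2) by (simp add: eval_form_mult)
  then have "eval_form k = 0" using \<open>eval_form g \<noteq> 0\<close> by simp
  moreover have "k \<noteq> 0" using k min_poly(1) by auto
  ultimately have "Polynomial.degree min_poly \<le> Polynomial.degree k" by (rule min_poly(3)[rotated])
  then have "Polynomial.degree g = 0" using k g(2) \<open>k \<noteq> 0\<close> by (simp add: degree_mult_eq)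
  then obtain u where u: "g = [:u:]" by (rule degree_eq_zeroE)
  then have "u \<noteq> 0" using g by simp
  have "eval_form a * eval_form s = pullback u"
    using arg_cong[OF ab, of eval_form]
    by (simp add: u eval_form_add eval_form_mult min_poly eval_form_const)
  then have "eval_form ([:inverse u:] * a) * eval_form s = pullback (inverse u) * pullback u"
    by (simp only: eval_form_mult eval_form_const mult.assoc)
  also have "\<dots> = 1" using \<open>u \<noteq> 0\<close> by (simp flip: pullback_mult)
  finally show ?thesis by blast
qed

text \<open>\<open>coordinate_relation\<close> reads \<open>q * x_j = - eval_form r\<close>. By
  \<open>separable\<close>, \<open>q\<close> is nonzero, so its inverse again lies in the image of
  \<open>eval_form\<close>.\<close>

lemma var_in_range_eval_form: "\<exists>s. eval_form s = ratfun_var j"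
proof -
  define q where "q = eval_form (\<Sum>a\<le>A. Polynomial.monom (of_nat a * Fract (C a) 1) (a - 1))"
  define r where "r = (\<Sum>a\<le>A. Polynomial.monom (of_nat 1 * Fract (R j a) 1) a)"
  have q: "has_value q x (\<Sum>a\<le>A. real a * mpoly_eval (C a) (F x) * form x ^ (a - 1))" for x
    using has_value_eval_form_sum[of "\<lambda>a. a" C "\<lambda>a. a - 1" A x] by (simp add: q_def)
  have r: "has_value (eval_form r) x (\<Sum>a\<le>A. mpoly_eval (R j a) (F x) * form x ^ a)" for x
    using has_value_eval_form_sum[of "\<lambda>_. 1" "R j" "\<lambda>a. a" A x] by (simp add: r_def)
  have "q \<noteq> 0"
  proof
    assume "q = 0"
    then have "(\<Sum>a\<le>A. real a * mpoly_eval (C a) (F x) * form x ^ (a - 1)) = 0" for x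
      using has_value_unique[OF q[of x]] has_value_0 by blast
    with separable show False by blast
  qed
  then obtain t where t: "eval_form t * q = 1"
    unfolding q_def using eval_form_invertible by blast
  have "q * ratfun_var j + eval_form r = 0"
  proof (rule has_value_0_imp)
    fix x
    show "has_value (q * ratfun_var j + eval_form r) x 0"
      using has_value_add[OF has_value_mult[OF q[of x] has_value_ratfun_var[of j]] r[of x]]
      by (simp only: coordinate_relation)
  qed
  then have "q * ratfun_var j = - eval_form r" by (simp add: eq_neg_iff_add_eq_0)
  then have "eval_form t * q * ratfun_var j = eval_form (- t * r)"
    by (simp add: mult.assoc eval_form_mult eval_form_uminus)
  then show ?thesis by (metis t mult_1)
qed

text \<open>Specialised at a generic target point, it recovers coordinate \<open>j\<close> of a
  point of the fiber from the value of the linear form.\<close>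

definition coordinate_poly :: "'n \<Rightarrow> 'n ratfun poly" where
  "coordinate_poly j = (SOME s. eval_form s = ratfun_var j)"

lemma eval_coordinate_poly: "eval_form (coordinate_poly j) = ratfun_var j"
  unfolding coordinate_poly_def by (rule someI_ex[OF var_in_range_eval_form])

lemma eval_form_subst_coordinate_poly:
  "eval_form (mpoly_subst (\<lambda>a. [:ratfun_const a:]) coordinate_poly p) = Fract p 1"
  by (simp add: eval_form_subst eval_coordinate_poly subst_ratfun_var)

text \<open>The image contains all polynomials and the inverses of its nonzero elements, hence all
  fractions: the linear form is primitive.\<close>

lemma eval_form_surj: "\<exists>s. eval_form s = r"
proof (cases r)
  case (Fract a b)
  have "Fract b 1 \<noteq> 0" using Fract by (simp add: Zero_fract_def eq_fract)
  then obtain t where t: "eval_form t * Fract b 1 = 1"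
    using eval_form_invertible eval_form_subst_coordinate_poly by metis
  obtain s where s: "eval_form s = Fract a 1"
    using eval_form_subst_coordinate_poly by blast
  have "r = Fract a 1 * inverse (Fract b 1)" using Fract by simp
  also have "inverse (Fract b 1) = eval_form t"
    using t by (intro inverse_unique) (simp add: mult.commute)
  also have "Fract a 1 * eval_form t = eval_form (s * t)"
    by (simp add: s eval_form_mult)
  finally show ?thesis by blast
qed

lemma degree_min_poly_pos: "Polynomial.degree min_poly > 0"
proof (rule ccontr)
  assume "\<not> ?thesis"
  then obtain u where u: "min_poly = [:u:]" by (auto elim: degree_eq_zeroE)
  then have "pullback u = 0" using min_poly(2) by (simp add: eval_form_const)
  with u min_poly(1) show False by (simp add: pullback_eq_0_iff)
qed

end

section \<open>The extension degree\<close>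

lemma ring_of_type_algebra_simps [simp]:
  "carrier ring_of_type_algebra = UNIV"
  "x \<otimes>\<^bsub>ring_of_type_algebra\<^esub> y = x * y"
  "x \<oplus>\<^bsub>ring_of_type_algebra\<^esub> y = x + y"
  "\<one>\<^bsub>ring_of_type_algebra\<^esub> = 1"
  "\<zero>\<^bsub>ring_of_type_algebra\<^esub> = 0"
  by (simp_all add: ring_of_type_algebra_def)

lemma a_inv_ring_of_type_algebra: "\<ominus>\<^bsub>ring_of_type_algebra\<^esub> x = - (x :: 'a::field)"
proof -
  interpret field "ring_of_type_algebra :: 'a ring" by (rule field_from_type_algebra)
  show ?thesis by (rule minus_equality) auto
qed

lemma m_inv_ring_of_type_algebra: "x \<noteq> 0 \<Longrightarrow> inv\<^bsub>ring_of_type_algebra\<^esub> x = inverse (x :: 'a::field)"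
proof -
  interpret field "ring_of_type_algebra :: 'a ring" by (rule field_from_type_algebra)
  assume "x \<noteq> 0"
  then show ?thesis by (intro comm_inv_char) auto
qed

context
  fixes H :: "'a::field set"
begin

abbreviation "gen \<equiv> generate_field (ring_of_type_algebra :: 'a ring) H"

lemma generate_field_0: "0 \<in> gen"
proof -
  interpret field "ring_of_type_algebra :: 'a ring" by (rule field_from_type_algebra)
  show ?thesis using zero_in_generate[of H] by simp
qed

lemma generate_field_1: "1 \<in> gen"
  using generate_field.one[of "ring_of_type_algebra :: 'a ring" H] by simp

lemma generate_field_add: "x \<in> gen \<Longrightarrow> y \<in> gen \<Longrightarrow> x + y \<in> gen"
  using generate_field.eng_add[of x "ring_of_type_algebra :: 'a ring" H y] by simp

lemma generate_field_mult: "x \<in> gen \<Longrightarrow> y \<in> gen \<Longrightarrow> x * y \<in> gen"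
  using generate_field.eng_mult[of x "ring_of_type_algebra :: 'a ring" H y] by simp

lemma generate_field_inverse: "x \<in> gen \<Longrightarrow> inverse x \<in> gen"
  \<comment> \<open>The rule covers nonzero elements; at 0 the convention
    \<open>inverse 0 = 0\<close> gives membership.\<close>
  using generate_field.m_inv[of x "ring_of_type_algebra :: 'a ring" H]
  by (cases "x = 0") (auto simp: generate_field_0 m_inv_ring_of_type_algebra)

lemma generate_field_sum: "(\<And>s. s \<in> S \<Longrightarrow> g s \<in> gen) \<Longrightarrow> (\<Sum>s\<in>S. g s) \<in> gen"
  by (induction S rule: infinite_finite_induct) (auto intro: generate_field_0 generate_field_add)

lemma generate_field_prod: "(\<And>s. s \<in> S \<Longrightarrow> g s \<in> gen) \<Longrightarrow> (\<Prod>s\<in>S. g s) \<in> gen"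
  by (induction S rule: infinite_finite_induct) (auto intro: generate_field_1 generate_field_mult)

lemma generate_field_power: "x \<in> gen \<Longrightarrow> x ^ k \<in> gen"
  by (induction k) (auto intro: generate_field_1 generate_field_mult)

end

context primitive_rational_map
begin

text \<open>Any other quotient for the same component takes the same values everywhere, hence is the
  same fraction.\<close>

lemma component_ratfuns_eq: "component_ratfuns F = range component"
proof
  show "component_ratfuns F \<subseteq> range component"
  proof
    fix r assume "r \<in> component_ratfuns F"
    then obtain p q i where r: "r = Fract p q" and pq: "regular_quotient (\<lambda>x. F x $ i) p q"
      unfolding component_ratfuns_def by blast
    have "has_value r x (F x $ i)" for x
      using pq has_value_quotient[of q x p] by (simp add: r regular_quotient_def)
    then have "r = component i" by (rule has_value_eqI[OF _ has_value_component])
    then show "r \<in> range component" by blast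
  qed
  have "regular_quotient (\<lambda>x. F x $ i) (P i) (Q i)" for i
    by (simp add: regular_quotient_def Q_nonzero F_eq)
  then show "range component \<subseteq> component_ratfuns F"
    by (auto simp: component_ratfuns_def component_def)
qed

text \<open>The image of \<open>pullback\<close> is closed under the field operations and contains
  the generators; conversely its elements are quotients of polynomial expressions in the
  generators.\<close>

lemma component_field_eq: "component_field F = range pullback"
proof
  have gens: "ratfun_constants \<union> component_ratfuns F \<subseteq> range pullback"
    unfolding component_ratfuns_eq ratfun_constants_def
    using pullback_const pullback_var by (auto simp: ratfun_const_def[symmetric] intro: range_eqI[OF sym])
  show "component_field F \<subseteq> range pullback"
  proof
    fix r assume "r \<in> component_field F"
    then show "r \<in> range pullback"
      unfolding component_field_def
    proof (induction r rule: generate_field.induct)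
      case one
      show ?case by (simp add: image_iff exI[of _ 1])
    next
      case (incl h)
      then show ?case using gens by blast
    next
      case (a_inv h)
      then show ?case by (auto simp: a_inv_ring_of_type_algebra simp flip: pullback_uminus)
    next
      case (m_inv h)
      then show ?case by (auto simp: m_inv_ring_of_type_algebra inverse_pullback)
    next
      case (eng_add h1 h2)
      then show ?case by (auto simp flip: pullback_add)
    next
      case (eng_mult h1 h2)
      then show ?case by (auto simp flip: pullback_mult)
    qed
  qed
  have poly: "pullback_poly a \<in> component_field F" for a
    unfolding pullback_poly_def mpoly_subst_def component_field_def
    by (intro generate_field_sum generate_field_mult generate_field_prod generate_field_power generate_field.incl)
      (auto simp: component_ratfuns_eq ratfun_constants_def ratfun_const_def)
  show "range pullback \<subseteq> component_field F"
  proof clarify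
    fix r :: "'n ratfun"
    show "pullback r \<in> component_field F"
    proof (cases r)
      case (Fract a b)
      then have "pullback r = pullback_poly a * inverse (pullback_poly b)"
        by (simp add: pullback_Fract divide_inverse)
      with poly[of a] poly[of b] show ?thesis
        unfolding component_field_def by (simp add: generate_field_mult generate_field_inverse)
    qed
  qed
qed

text \<open>Below the degree of \<open>min_poly\<close> each new power of the linear form is
  independent of the earlier ones, so each adds one dimension.\<close>

lemma dimension_powers_of_form:
  assumes "m \<le> Polynomial.degree min_poly"
  shows "ring.dimension ratfun_field m (range pullback)
    {r. \<exists>g. r = (\<Sum>k<m. pullback (g k) * form_ratfun ^ k)}"
proof -
  interpret field "ratfun_field :: 'n ratfun ring" by (rule field_from_type_algebra)
  show ?thesis using assms
  proof (induction m)
    case 0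
    then show ?case using zero_dim[of "range pullback"] by simp
  next
    case (Suc m)
    let ?E = "\<lambda>m. {r. \<exists>g. r = (\<Sum>k<m. pullback (g k) * form_ratfun ^ k)}"
    have "form_ratfun ^ m \<notin> ?E m"
    proof
      assume "form_ratfun ^ m \<in> ?E m"
      then obtain g where g: "form_ratfun ^ m = (\<Sum>k<m. pullback (g k) * form_ratfun ^ k)" by blast
      \<comment> \<open>A dependence of the \<open>m\<close>-th power on lower ones gives a monic
        kernel element of degree \<open>m\<close>, below that of \<open>min_poly\<close>.\<close>
      define s where "s = Polynomial.monom 1 m - (\<Sum>k<m. Polynomial.monom (g k) k)"
      have coeff: "Polynomial.coeff s k = (if k = m then 1 else if k < m then - g k else 0)" for k
        by (simp add: s_def Polynomial.coeff_sum)
      then have "s \<noteq> 0" by (metis Polynomial.coeff_0 zero_neq_one)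
      have deg: "Polynomial.degree s \<le> m" by (rule degree_le) (simp add: coeff)
      have "eval_form s = (\<Sum>k<Suc m. pullback (Polynomial.coeff s k) * form_ratfun ^ k)"
        using eval_form_eq_sum[OF deg] by (simp only: lessThan_Suc_atMost)
      also have "\<dots> = form_ratfun ^ m + (\<Sum>k<m. pullback (- g k) * form_ratfun ^ k)"
        by (simp add: coeff)
      also have "\<dots> = 0" by (simp add: g pullback_uminus sum_negf)
      finally have "eval_form s = 0" .
      with min_poly(3) \<open>s \<noteq> 0\<close> deg Suc.prems show False by fastforce
    qed
    moreover have "dimension m (range pullback) (?E m)" using Suc by simp
    ultimately have dim: "dimension (Suc m) (range pullback) (line_extension (range pullback) (form_ratfun ^ m) (?E m))"
      by (intro Suc_dim) auto
    have "u \<in> line_extension (range pullback) (form_ratfun ^ m) (?E m) \<longleftrightarrow> u \<in> ?E (Suc m)" for u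
    proof
      assume "u \<in> line_extension (range pullback) (form_ratfun ^ m) (?E m)"
      then obtain t g where u: "u = pullback t * form_ratfun ^ m + (\<Sum>k<m. pullback (g k) * form_ratfun ^ k)"
        unfolding line_extension_mem_iff by auto
      have "(\<Sum>k<m. pullback (g k) * form_ratfun ^ k) = (\<Sum>k<m. pullback ((g(m := t)) k) * form_ratfun ^ k)"
        by (intro sum.cong) auto
      then have "u = (\<Sum>k<Suc m. pullback ((g(m := t)) k) * form_ratfun ^ k)" by (simp add: u)
      then show "u \<in> ?E (Suc m)" by blast
    next
      assume "u \<in> ?E (Suc m)"
      then obtain g where "u = (\<Sum>k<Suc m. pullback (g k) * form_ratfun ^ k)" by blast
      then have "u = pullback (g m) * form_ratfun ^ m + (\<Sum>k<m. pullback (g k) * form_ratfun ^ k)" by simp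
      then show "u \<in> line_extension (range pullback) (form_ratfun ^ m) (?E m)"
        unfolding line_extension_mem_iff by auto
    qed
    then have "line_extension (range pullback) (form_ratfun ^ m) (?E m) = ?E (Suc m)" by blast
    with dim show ?case by simp
  qed
qed

text \<open>Every element is the image of a remainder modulo \<open>min_poly\<close>, so the powers
  below its degree span the whole field.\<close>

lemma extension_degree_eq: "extension_degree F = Polynomial.degree min_poly"
proof -
  interpret field "ratfun_field :: 'n ratfun ring" by (rule field_from_type_algebra)
  let ?d = "Polynomial.degree min_poly"
  have "r \<in> {r. \<exists>g. r = (\<Sum>k<?d. pullback (g k) * form_ratfun ^ k)}" for r
  proof -
    obtain s where "eval_form s = r" using eval_form_surj by blast
    then have s: "eval_form (s mod min_poly) = r" by (simp add: eval_form_mod_min_poly)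
    have "Polynomial.degree (s mod min_poly) \<le> ?d - 1"
      using degree_mod_less[OF min_poly(1), of s] degree_min_poly_pos by auto
    moreover have "{..?d - 1} = {..<?d}" using degree_min_poly_pos by auto
    ultimately have "r = (\<Sum>k<?d. pullback (Polynomial.coeff (s mod min_poly) k) * form_ratfun ^ k)"
      using eval_form_eq_sum[of "s mod min_poly" "?d - 1"] s by simp
    then show ?thesis by blast
  qed
  then have "{r. \<exists>g. r = (\<Sum>k<?d. pullback (g k) * form_ratfun ^ k)} = UNIV"
    by (rule UNIV_eq_I[symmetric])
  then have "dimension ?d (range pullback) UNIV"
    using dimension_powers_of_form[of ?d] by simp
  moreover have "subfield (range pullback) (ratfun_field :: 'n ratfun ring)"
    using generate_field_is_subfield[of "ratfun_constants \<union> component_ratfuns F"]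
    by (simp add: component_field_eq[symmetric] component_field_def)
  ultimately show ?thesis
    using dimI[of "range pullback" ?d UNIV] by (simp add: extension_degree_def component_field_eq over_def)
qed

end

section \<open>Fibers\<close>

text \<open>Far out the sign is that of the leading coefficient. The reflected polynomial
  \<open>q\<close> treats the negative half-line and has the opposite leading coefficient, so the
  intermediate value theorem applies.\<close>

lemma odd_degree_imp_real_root:
  fixes p :: "real poly"
  assumes "odd (Polynomial.degree p)"
  shows "\<exists>z. poly p z = 0"
proof -
  have unbounded: "\<exists>n. \<forall>z\<ge>n. sgn (poly q z) = sgn (Polynomial.lead_coeff q)" if "q \<noteq> 0" for q :: "real poly"
  proof (cases "Polynomial.lead_coeff q > 0")
    case True
    then obtain n where "\<forall>z\<ge>n. poly q z \<ge> Polynomial.lead_coeff q" using poly_pinfty_gt_lc by blast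
    with True have "\<forall>z\<ge>n. sgn (poly q z) = sgn (Polynomial.lead_coeff q)"
      by (metis less_le_trans sgn_pos)
    then show ?thesis ..
  next
    case False
    with that have neg: "Polynomial.lead_coeff (- q) > 0"
      by (metis Polynomial.coeff_minus degree_minus leading_coeff_0_iff linorder_neqE_linordered_idom neg_0_less_iff_less)
    then obtain n where n: "\<forall>z\<ge>n. poly (- q) z \<ge> Polynomial.lead_coeff (- q)" using poly_pinfty_gt_lc by blast
    have "sgn (poly q z) = sgn (Polynomial.lead_coeff q)" if "z \<ge> n" for z
    proof -
      have "poly (- q) z > 0" using n neg that less_le_trans by blast
      then show ?thesis using neg by simp
    qed
    then show ?thesis by blast
  qed
  define q where "q = p \<circ>\<^sub>p [:0, -1:]"
  have p0: "p \<noteq> 0" using assms by auto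
  have lc: "Polynomial.lead_coeff q = - Polynomial.lead_coeff p"
    using assms by (simp add: q_def lead_coeff_comp)
  then have "q \<noteq> 0" using p0 by auto
  obtain n where n: "\<forall>z\<ge>n. sgn (poly p z) = sgn (Polynomial.lead_coeff p)" using unbounded[OF p0] by blast
  obtain k where k: "\<forall>z\<ge>k. sgn (poly q z) = sgn (Polynomial.lead_coeff q)" using unbounded[OF \<open>q \<noteq> 0\<close>] by blast
  define b where "b = max (max n k) 1"
  have b: "sgn (poly p b) = sgn (Polynomial.lead_coeff p)" "sgn (poly p (- b)) = - sgn (Polynomial.lead_coeff p)"
    using n k lc by (auto simp: b_def q_def poly_pcompose sgn_minus)
  have "- b < b" by (simp add: b_def)
  moreover have "sgn (poly p (- b) * poly p b) < 0"
    using p0 by (simp add: sgn_mult b)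
  then have "poly p (- b) * poly p b < 0" by (simp only: sgn_less)
  ultimately show ?thesis using poly_IVT by blast
qed

text \<open>Splitting off a linear factor at a real root lowers degree and root count by one, since
  simple roots do not recur in the quotient. Without real roots the degree is even.\<close>

lemma card_simple_real_roots_parity:
  fixes p :: "real poly"
  assumes "p \<noteq> 0" "\<And>z. poly p z = 0 \<Longrightarrow> poly (pderiv p) z \<noteq> 0"
  shows "even (card {z. poly p z = 0}) \<longleftrightarrow> even (Polynomial.degree p)"
  using assms
proof (induction "Polynomial.degree p" arbitrary: p rule: less_induct)
  case less
  show ?case
  proof (cases "\<exists>z. poly p z = 0")
    case False
    then have "{z. poly p z = 0} = {}" by blast
    moreover have "even (Polynomial.degree p)" using odd_degree_imp_real_root False by blast
    ultimately show ?thesis by simp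
  next
    case True
    then obtain r where r: "poly p r = 0" by blast
    then obtain q where q: "p = [:- r, 1:] * q" by (auto simp: poly_eq_0_iff_dvd)
    then have "q \<noteq> 0" using less.prems by auto
    then have deg: "Polynomial.degree p = Suc (Polynomial.degree q)"
      unfolding q by (subst degree_mult_eq) auto
    have deriv: "poly (pderiv p) z = (z - r) * poly (pderiv q) z + poly q z" for z
      by (simp add: q pderiv_mult pderiv_pCons del: mult_pCons_left)
    have "poly (pderiv q) z \<noteq> 0" if "poly q z = 0" for z
      using less.prems(2)[of z] deriv[of z] that by (auto simp: q)
    then have IH: "even (card {z. poly q z = 0}) \<longleftrightarrow> even (Polynomial.degree q)"
      using less.hyps[of q] deg \<open>q \<noteq> 0\<close> by simp
    have "poly q r \<noteq> 0" using less.prems(2)[OF r] deriv[of r] by simp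
    moreover have "{z. poly p z = 0} = insert r {z. poly q z = 0}"
      by (auto simp: q)
    ultimately have "card {z. poly p z = 0} = Suc (card {z. poly q z = 0})"
      using poly_roots_finite[OF \<open>q \<noteq> 0\<close>] by simp
    with IH deg show ?thesis by simp
  qed
qed

lemma poly_mpoly_subst:
  "poly (mpoly_subst (\<lambda>c. [:c:]) G p) z = mpoly_eval p (\<chi> i. poly (G i) z)"
  by (simp only: mpoly_subst_def mpoly_eval_def poly_sum poly_mult poly_prod poly_power)
    (simp add: mult.commute)

section \<open>Fibers over nearby points\<close>

lemma finite_set_separated:
  fixes S :: "'a::metric_space set"
  assumes "finite S"
  shows "\<exists>d>0. \<forall>s\<in>S. \<forall>t\<in>S. s \<noteq> t \<longrightarrow> ball s d \<inter> ball t d = {}"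
proof -
  have "\<forall>s\<in>S. \<exists>d>0. \<forall>x\<in>S. x \<noteq> s \<longrightarrow> d \<le> dist s x"
    using finite_set_avoid[OF assms] by blast
  then obtain e where e: "\<And>s. s \<in> S \<Longrightarrow> e s > 0" "\<And>s x. s \<in> S \<Longrightarrow> x \<in> S \<Longrightarrow> x \<noteq> s \<Longrightarrow> e s \<le> dist s x"
    by metis
  \<comment> \<open>The inserted 1 keeps the minimum defined for empty \<open>S\<close>; halving
    makes the balls disjoint.\<close>
  define d where "d = Min (insert 1 (e ` S)) / 2"
  have d: "d > 0" using assms e(1) by (simp add: d_def)
  have "2 * d \<le> dist s x" if "s \<in> S" "x \<in> S" "x \<noteq> s" for s x
  proof -
    have "2 * d \<le> e s" using assms that by (simp add: d_def)
    with e(2)[OF that] show ?thesis by linarith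
  qed
  then have "ball s d \<inter> ball t d = {}" if "s \<in> S" "t \<in> S" "s \<noteq> t" for s t
  proof -
    have False if "z \<in> ball s d" "z \<in> ball t d" for z
    proof -
      have "dist s t < 2 * d"
        using that dist_triangle_less_add[of s z d t d] by (simp add: dist_commute)
      moreover have "2 * d \<le> dist s t"
        using \<open>\<And>s x. s \<in> S \<Longrightarrow> x \<in> S \<Longrightarrow> x \<noteq> s \<Longrightarrow> 2 * d \<le> dist s x\<close> \<open>s \<in> S\<close> \<open>t \<in> S\<close> \<open>s \<noteq> t\<close> by metis
      ultimately show False by linarith
    qed
    then show ?thesis by blast
  qed
  with d show ?thesis by blast
qed

context open_rational_map
begin

text \<open>Disjoint balls around the points of \<open>S\<close> have images that are neighbourhoods
  of \<open>y0\<close>; a point in all of them has a preimage in each ball. A subset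
  \<open>S'\<close> is used because the cardinality of an infinite fiber would be 0.\<close>

lemma fiber_size_lower_semicontinuous:
  assumes "finite S" "S \<subseteq> F -` {y0}"
  shows "\<exists>V. open V \<and> y0 \<in> V \<and> (\<forall>y\<in>V. \<exists>S'. S' \<subseteq> F -` {y} \<and> card S' = card S)"
proof -
  obtain d where d: "d > 0" "\<And>s t. s \<in> S \<Longrightarrow> t \<in> S \<Longrightarrow> s \<noteq> t \<Longrightarrow> ball s d \<inter> ball t d = {}"
    using finite_set_separated[OF assms(1)] by blast
  define V where "V = (\<Inter>s\<in>S. interior (F ` ball s d))"
  have "open V" unfolding V_def using assms(1) by (intro open_INT) auto
  moreover have "y0 \<in> V"
    unfolding V_def
  proof
    fix s assume "s \<in> S"
    then have "F s = y0" using assms(2) by blast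
    then show "y0 \<in> interior (F ` ball s d)"
      using interior_image[of "ball s d" s] d(1) by simp
  qed
  moreover have "\<exists>S'. S' \<subseteq> F -` {y} \<and> card S' = card S" if "y \<in> V" for y
  proof -
    have "\<exists>x. x \<in> ball s d \<and> F x = y" if "s \<in> S" for s
    proof -
      have "y \<in> F ` ball s d" using \<open>y \<in> V\<close> that interior_subset unfolding V_def by blast
      then show ?thesis by blast
    qed
    then obtain g where g: "\<And>s. s \<in> S \<Longrightarrow> g s \<in> ball s d" "\<And>s. s \<in> S \<Longrightarrow> F (g s) = y"
      by metis
    have "inj_on g S"
    proof (rule inj_onI, rule ccontr)
      fix s t assume st: "s \<in> S" "t \<in> S" "g s = g t" "s \<noteq> t"
      then have "g s \<in> ball s d \<inter> ball t d" using g(1)[of s] g(1)[of t] by simp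
      with d(2)[OF st(1,2,4)] show False by blast
    qed
    then show ?thesis using g(2)
      by (intro exI[of _ "g ` S"]) (auto simp: card_image)
  qed
  ultimately show ?thesis by blast
qed

end

section \<open>Fiber sizes and the extension degree\<close>

context primitive_rational_map
begin

text \<open>The cofactor of \<open>min_poly\<close> can be specialised at generic points too.
  Identities in the function field thus become congruences modulo a real polynomial.\<close>

lemma eval_form_zero_factor:
  assumes "eval_form s = 0"
  shows "eventually (\<lambda>y. \<forall>S M. has_poly_value s y S \<longrightarrow> has_poly_value min_poly y M \<longrightarrow> M dvd S) generic"
proof -
  obtain w where w: "s = min_poly * w" using assms eval_form_eq_0_iff by (auto simp: dvd_def)
  show ?thesis
    using eventually_has_poly_value[of w]
  proof eventually_elim
    case (elim y)
    then obtain W where "has_poly_value w y W" by blast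
    have "M dvd S" if "has_poly_value s y S" "has_poly_value min_poly y M" for S M
    proof (rule dvdI)
      show "S = M * W"
        using that(1) has_poly_value_mult[OF that(2) \<open>has_poly_value w y W\<close>]
        unfolding w by (rule has_poly_value_unique)
    qed
    then show ?case by blast
  qed
qed

text \<open>The fiber corresponds to the real roots of the specialised minimal polynomial
  \<open>M\<close>, via \<open>form\<close> in one direction and the coordinate polynomials in the
  other.\<close>

lemma generic_fiber_card:
  "eventually (\<lambda>y. finite (F -` {y}) \<and> card (F -` {y}) \<le> extension_degree F \<and>
     (even (card (F -` {y})) \<longleftrightarrow> even (extension_degree F))) generic"
proof -
  \<comment> \<open>\<open>lin\<close> encodes that the recovered coordinates reproduce the linear
    form; \<open>fib j\<close> encodes \<open>P j = y_j * Q j\<close> at the recovered point, with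
    \<open>ratfun_var j\<close> as target coordinate.\<close>
  define lin where "lin = (\<Sum>j\<in>UNIV. [:ratfun_const (c $ j):] * coordinate_poly j) - [:0, 1:]"
  define fib where "fib j = mpoly_subst (\<lambda>a. [:ratfun_const a:]) coordinate_poly (P j)
      - [:ratfun_var j:] * mpoly_subst (\<lambda>a. [:ratfun_const a:]) coordinate_poly (Q j)" for j
  have lin0: "eval_form lin = 0"
    by (simp only: lin_def eval_form_diff eval_form_sum eval_form_mult eval_form_const pullback_const
        eval_coordinate_poly eval_form_X) (simp add: form_ratfun_def)
  have fib0: "eval_form (fib j) = 0" for j
  proof -
    have "Q j \<noteq> 0" using Q_nonzero mpoly_eval_nonzero_imp by blast
    then have "component j * Fract (Q j) 1 = Fract (P j) 1"
      by (simp add: component_def eq_fract)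
    then show ?thesis
      by (simp only: fib_def eval_form_diff eval_form_mult eval_form_const pullback_var
          eval_form_subst_coordinate_poly) simp
  qed
  \<comment> \<open>In characteristic zero the derivative is nonzero and of smaller degree than
    \<open>min_poly\<close>, so it cannot lie in the kernel.\<close>
  have "eval_form (pderiv min_poly) \<noteq> 0"
  proof
    assume z: "eval_form (pderiv min_poly) = 0"
    have "Polynomial.coeff (pderiv min_poly) (Polynomial.degree min_poly - 1) \<noteq> 0"
    proof -
      have "of_nat k \<noteq> (0 :: 'n ratfun)" if "k > 0" for k
      proof
        assume "of_nat k = (0 :: 'n ratfun)"
        then have "has_value (0 :: 'n ratfun) 0 (of_nat k)"
          using has_value_of_nat by metis
        from has_value_unique[OF this has_value_0] that show False by simp
      qed
      then show ?thesis
        using degree_min_poly_pos min_poly(1) by (simp add: Polynomial.coeff_pderiv del: of_nat_Suc)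
    qed
    then have "pderiv min_poly \<noteq> 0" by auto
    moreover have "Polynomial.degree (pderiv min_poly) < Polynomial.degree min_poly"
    proof -
      have "Polynomial.degree (pderiv min_poly) \<le> Polynomial.degree min_poly - 1"
        by (rule degree_le) (auto simp: Polynomial.coeff_pderiv Polynomial.coeff_eq_0)
      with degree_min_poly_pos show ?thesis by linarith
    qed
    ultimately show False using min_poly(3) z by fastforce
  qed
  then obtain b where "eval_form b * eval_form (pderiv min_poly) = 1"
    using eval_form_invertible by blast
  \<comment> \<open>Specialised, this identity says that the derivative of \<open>M\<close> is
    invertible modulo \<open>M\<close>, so all roots of \<open>M\<close> are simple.\<close>
  then have simple0: "eval_form (b * pderiv min_poly - 1) = 0"
    by (simp add: eval_form_diff eval_form_mult)
  have fib_ev: "eventually (\<lambda>y. \<forall>j\<in>UNIV. \<forall>S M. has_poly_value (fib j) y S \<longrightarrow>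
      has_poly_value min_poly y M \<longrightarrow> M dvd S) generic"
    by (intro eventually_ball_finite ballI eval_form_zero_factor fib0) simp
  have "eventually (\<lambda>y. \<forall>j\<in>UNIV. \<exists>S. has_poly_value (coordinate_poly j) y S) generic"
    by (intro eventually_ball_finite ballI eventually_has_poly_value) simp
  moreover have "eventually (\<lambda>y. \<exists>v. has_value (Polynomial.lead_coeff min_poly) y v \<and> v \<noteq> 0) generic"
    using min_poly(1) by (intro eventually_has_value_nonzero) simp
  ultimately show ?thesis
    using eval_form_zero_factor[OF lin0] fib_ev eval_form_zero_factor[OF simple0] eventually_has_poly_value[of min_poly] eventually_has_poly_value[of b]
  proof eventually_elim
    case (elim y)
    obtain M where M: "has_poly_value min_poly y M" using elim by blast
    obtain B where B: "has_poly_value b y B" using elim by blast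
    obtain G where G: "\<And>j. has_poly_value (coordinate_poly j) y (G j)"
      using bchoice[OF elim(1)] by auto
    have lin: "M dvd (\<Sum>j\<in>UNIV. [:c $ j:] * G j) - [:0, 1:]"
    proof -
      have X: "has_poly_value [:0, 1:] y [:0, 1:]"
        using has_poly_value_monom[OF has_value_1[of y], of 1] by (simp add: Polynomial.monom_altdef)
      have "has_poly_value lin y ((\<Sum>j\<in>UNIV. [:c $ j:] * G j) - [:0, 1:])"
        unfolding lin_def
        by (intro has_poly_value_diff has_poly_value_sum has_poly_value_mult has_poly_value_const
            has_value_ratfun_const G X)
      with elim M show ?thesis by blast
    qed
    have fib: "M dvd mpoly_subst (\<lambda>c. [:c:]) G (P j) - [:y $ j:] * mpoly_subst (\<lambda>c. [:c:]) G (Q j)" for j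
    proof -
      have "has_poly_value (fib j) y (mpoly_subst (\<lambda>c. [:c:]) G (P j) - [:y $ j:] * mpoly_subst (\<lambda>c. [:c:]) G (Q j))"
        unfolding fib_def
        by (intro has_poly_value_diff has_poly_value_mult has_poly_value_const has_value_ratfun_var
            has_poly_value_subst G)
      with elim M show ?thesis by blast
    qed
    have simple: "M dvd B * pderiv M - 1"
    proof -
      have "has_poly_value (b * pderiv min_poly - 1) y (B * pderiv M - 1)"
        by (intro has_poly_value_diff has_poly_value_mult has_poly_value_pderiv has_poly_value_1 B M)
      with elim M show ?thesis by blast
    qed
    \<comment> \<open>The leading coefficient is nonzero at generic \<open>y\<close>, so the degree
      does not drop.\<close>
    have deg: "Polynomial.degree M = Polynomial.degree min_poly"
    proof (rule antisym)
      show "Polynomial.degree M \<le> Polynomial.degree min_poly"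
      proof (rule degree_le, intro allI impI)
        fix k assume "k > Polynomial.degree min_poly"
        then have "has_value 0 y (Polynomial.coeff M k)"
          using M by (metis Polynomial.coeff_eq_0 has_poly_value_def)
        then show "Polynomial.coeff M k = 0" using has_value_unique has_value_0 by blast
      qed
      have "Polynomial.coeff M (Polynomial.degree min_poly) \<noteq> 0"
        using elim(2) M has_value_unique unfolding has_poly_value_def by metis
      then show "Polynomial.degree min_poly \<le> Polynomial.degree M" by (rule le_degree)
    qed
    then have "M \<noteq> 0" using degree_min_poly_pos by auto
    have fiber_value: "poly M (form x) = 0" "x $ j = poly (G j) (form x)" if "F x = y" for x j
    proof -
      have "has_value (eval_form min_poly) x (poly M (form x))"
        by (rule has_value_eval_form) (use M that in simp)
      then show "poly M (form x) = 0" using has_value_unique has_value_0 min_poly(2) by metis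
      have "has_value (eval_form (coordinate_poly j)) x (poly (G j) (form x))"
        by (rule has_value_eval_form) (use G that in simp)
      then show "x $ j = poly (G j) (form x)"
        using has_value_unique has_value_ratfun_var eval_coordinate_poly by metis
    qed
    \<comment> \<open>\<open>fib\<close> puts the recovered point into the fiber, \<open>lin\<close>
      shows that its form is \<open>z\<close>, and \<open>fiber_value\<close> handles the other
      composition.\<close>
    have "bij_betw form (F -` {y}) {z. poly M z = 0}"
    proof (rule bij_betwI[where g = "\<lambda>z. \<chi> j. poly (G j) z"])
      show "form \<in> F -` {y} \<rightarrow> {z. poly M z = 0}" using fiber_value by auto
      show "(\<chi> j. poly (G j) (form x)) = x" if "x \<in> F -` {y}" for x
      proof -
        have "F x = y" using that by simp
        from fiber_value(2)[OF this] show ?thesis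
          unfolding vec_eq_iff vec_lambda_beta by metis
      qed
      have root: "poly S z = 0" if "M dvd S" "z \<in> {z. poly M z = 0}" for S z
        using that by (auto simp: dvd_def)
      show "form (\<chi> j. poly (G j) z) = z" if "z \<in> {z. poly M z = 0}" for z
        using root[OF lin that] by (simp add: poly_sum)
      have "F (\<chi> j. poly (G j) z) $ j = y $ j" if "z \<in> {z. poly M z = 0}" for z j
        using root[OF fib[of j] that] Q_nonzero[of j "\<chi> j. poly (G j) z"]
        by (simp add: poly_mpoly_subst F_eq)
      then show "(\<lambda>z. \<chi> j. poly (G j) z) \<in> {z. poly M z = 0} \<rightarrow> F -` {y}"
        by (simp add: vec_eq_iff)
    qed
    then have fin: "finite (F -` {y})" and card: "card (F -` {y}) = card {z. poly M z = 0}"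
      using poly_roots_finite[OF \<open>M \<noteq> 0\<close>] bij_betw_finite bij_betw_same_card by blast+
    have "poly (pderiv M) z \<noteq> 0" if "poly M z = 0" for z
    proof
      assume "poly (pderiv M) z = 0"
      moreover obtain k where "B * pderiv M - 1 = M * k" using simple by (auto simp: dvd_def)
      then have "poly (B * pderiv M - 1) z = poly (M * k) z" by simp
      ultimately show False using that by simp
    qed
    then have "even (card {z. poly M z = 0}) \<longleftrightarrow> even (Polynomial.degree M)"
      by (rule card_simple_real_roots_parity[OF \<open>M \<noteq> 0\<close>])
    moreover have "card {z. poly M z = 0} \<le> Polynomial.degree M"
      by (rule card_poly_roots_bound[OF \<open>M \<noteq> 0\<close>])
    ultimately show ?case
      using fin by (simp add: card deg extension_degree_eq)
  qed
qed

text \<open>A finite part of any fiber is matched in size by the fiber over a nearby generic point,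
  where the bound is known. An infinite fiber would contain finite parts that are too large.\<close>

lemma fiber_card:
  "finite (F -` {y0}) \<and> card (F -` {y0}) \<le> extension_degree F"
proof -
  have bound: "card S \<le> extension_degree F" if S: "finite S" "S \<subseteq> F -` {y0}" for S
  proof -
    obtain V where V: "open V" "y0 \<in> V" "\<And>y. y \<in> V \<Longrightarrow> \<exists>S'. S' \<subseteq> F -` {y} \<and> card S' = card S"
      using fiber_size_lower_semicontinuous[OF S] by blast
    then obtain y where y: "y \<in> V" "finite (F -` {y})" "card (F -` {y}) \<le> extension_degree F"
      using eventually_generic_in_open[OF generic_fiber_card, of V] by blast
    with V(3) show ?thesis by (metis card_mono order_trans)
  qed
  have "finite (F -` {y0})"
  proof (rule ccontr)
    assume "infinite (F -` {y0})"
    then obtain S where "finite S" "card S = Suc (extension_degree F)" "S \<subseteq> F -` {y0}"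
      using infinite_arbitrarily_large by blast
    with bound show False by fastforce
  qed
  with bound show ?thesis by blast
qed

text \<open>Near a point with the largest fiber there is a generic point whose fiber is at least as
  large, hence of maximal size, and its parity is known.\<close>

lemma max_fiber_card_parity:
  "even (Max (range (\<lambda>y. card (F -` {y})))) \<longleftrightarrow> even (extension_degree F)"
proof -
  let ?N = "Max (range (\<lambda>y. card (F -` {y})))"
  \<comment> \<open>The bound on the fibers makes \<open>Max\<close> a genuine maximum that is
    attained.\<close>
  have fin: "finite (range (\<lambda>y. card (F -` {y})))"
  proof (rule finite_subset)
    show "range (\<lambda>y. card (F -` {y})) \<subseteq> {..extension_degree F}"
      using fiber_card by blast
  qed simp
  then have "?N \<in> range (\<lambda>y. card (F -` {y}))" by (intro Max_in) auto
  then obtain y0 where y0: "card (F -` {y0}) = ?N" by (metis (mono_tags, lifting) imageE)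
  obtain V where V: "open V" "y0 \<in> V" "\<And>y. y \<in> V \<Longrightarrow> \<exists>S'. S' \<subseteq> F -` {y} \<and> card S' = ?N"
    using fiber_size_lower_semicontinuous[OF fiber_card[THEN conjunct1] order_refl, of y0]
    unfolding y0 by blast
  then obtain y where y: "y \<in> V" "finite (F -` {y})" "even (card (F -` {y})) \<longleftrightarrow> even (extension_degree F)"
    using eventually_generic_in_open[OF generic_fiber_card, of V] by blast
  have "?N \<le> card (F -` {y})" using V(3)[OF y(1)] y(2) by (metis card_mono)
  moreover have "card (F -` {y}) \<le> ?N" using fin by (intro Max_ge) auto
  ultimately show ?thesis using y(3) by simp
qed

end

section \<open>Rational nonsingular maps are open\<close>

lemma rational_nonsingular_map_imp_open_rational_map:
  fixes F :: "real ^ 'n::{finite,linorder} \<Rightarrow> real ^ 'n::{finite,linorder}"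
  assumes "rational_nonsingular_map F"
  shows "\<exists>P Q. open_rational_map F P Q"
proof -
  have "\<forall>i. \<exists>p q. regular_quotient (\<lambda>x. F x $ i) p q" and det: "\<And>x. det (jacobian F (at x)) \<noteq> 0"
    using assms by (auto simp: rational_nonsingular_map_def everywhere_defined_rational_map_def)
  then obtain P Q where PQ: "\<And>i. regular_quotient (\<lambda>x. F x $ i) (P i) (Q i)" by metis
  have diff: "F differentiable (at x)" for x
  proof (rule differentiable_at_vecI)
    fix i
    have "(\<lambda>x. mpoly_eval (P i) x / mpoly_eval (Q i) x) differentiable (at x)"
      using PQ[of i] by (intro differentiable_divide mpoly_eval_differentiable) (simp add: regular_quotient_def)
    moreover have "(\<lambda>x. F x $ i) = (\<lambda>x. mpoly_eval (P i) x / mpoly_eval (Q i) x)"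
      using PQ[of i] by (auto simp: regular_quotient_def)
    ultimately show "(\<lambda>x. F x $ i) differentiable (at x)" by simp
  qed
  have "open_rational_map F P Q"
  proof
    show "mpoly_eval (Q i) x \<noteq> 0" "F x $ i = mpoly_eval (P i) x / mpoly_eval (Q i) x" for i x
      using PQ[of i] by (simp_all add: regular_quotient_def)
    show "F x \<in> interior (F ` U)" if "open U" "x \<in> U" for U x
      by (rule nonsingular_imp_interior_image[OF diff det that])
  qed
  then show ?thesis by blast
qed

theorem mainTheorem7:
  fixes F :: "real ^ 'n::{finite,linorder} \<Rightarrow> real ^ 'n::{finite,linorder}"
  assumes "rational_nonsingular_map F"
  shows "(\<forall>y. finite (F -` {y}) \<and> card (F -` {y}) \<le> extension_degree F) \<and>
         (even (Max (range (\<lambda>y. card (F -` {y})))) \<longleftrightarrow> even (extension_degree F))"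
proof -
  obtain P Q where "open_rational_map F P Q"
    using rational_nonsingular_map_imp_open_rational_map[OF assms] by blast
  then interpret open_rational_map F P Q .
  obtain c A C R where
    "\<And>x. (\<Sum>a\<le>A. mpoly_eval (C a) (F x) * (\<Sum>i\<in>UNIV. c $ i * x $ i) ^ a) = 0"
    "\<And>x j. (\<Sum>a\<le>A. real a * mpoly_eval (C a) (F x) * (\<Sum>i\<in>UNIV. c $ i * x $ i) ^ (a - 1)) * x $ j +
        (\<Sum>a\<le>A. mpoly_eval (R j a) (F x) * (\<Sum>i\<in>UNIV. c $ i * x $ i) ^ a) = 0"
    "\<exists>x. (\<Sum>a\<le>A. real a * mpoly_eval (C a) (F x) * (\<Sum>i\<in>UNIV. c $ i * x $ i) ^ (a - 1)) \<noteq> 0"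
    using primitive_linear_form by blast
  then interpret primitive_rational_map F P Q c A C R
    by unfold_locales
  show ?thesis using fiber_card max_fiber_card_parity by blast
qed

end
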